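(* For every positive integer $n$, in the ring $\mathbb{Z}[u,v][x_1,\ldots,x_n]$, \[ \mathcal{A}_n(u,v;x_1,\ldots,x_n)=\sum_{T\in \mathrm{TSPP}_{n-1}} \omega_{\pi(T)}(u,v)\, s_{\pi(T)}(x_1,\ldots,x_n), \] where, writing $\pi(T)=(a_1,\ldots,a_l\mid c_1,\ldots,c_l)$ in Frobenius notation, \[ \omega_{\pi(T)}(u,v)=u^{\sum_{i=1}^l (a_i+1)}\,(1-u-v)^{\sum_{i=1}^l (c_i-1-a_i)}\,v^{\binom{n}{2}-\sum_{i=1}^l c_i} \] (for $\pi(T)$ the empty partition, $l=0$ and $\omega=v^{\binom n2}$). Equivalently, if $\mathrm{diag}(T)=(a_1,\ldots,a_l\mid b_1,\ldots,b_l)$ then $c_i=b_i+1$ and $\omega_{\pi(T)}=u^{\sum(a_i+1)}(1-u-v)^{\sum(b_i-a_i)}v^{\binom n2-\sum (b_i+1)}$. For instance $\mathcal A_2=v+u\,s_{(1,1)}$ and $\mathcal A_3=v^3+uv^2s_{(1,1)}+u(1-u-v)v\,s_{(1,1,1)}+u^2v\,s_{(2,1,1)}+u^3s_{(2,2,2)}$.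
   Context: For variables $x_1,\ldots,x_n$, the antisymmetrizer is $\mathrm{ASym}_{x_1,\ldots,x_n} f(x_1,\ldots,x_n)=\sum_{\sigma\in S_n}\mathrm{sgn}(\sigma) f(x_{\sigma(1)},\ldots,x_{\sigma(n)})$. Define \[ \mathcal{A}_n(u,v;x_1,\ldots,x_n)=\frac{\mathrm{ASym}_{x_1,\ldots,x_n}\Big[\prod_{i=1}^n x_i^{i-1}\prod_{1\le i<j\le n}\big(v+(1-u-v)x_i+u x_i x_j\big)\Big]}{\prod_{1\le i<j\le n}(x_j-x_i)}. \] $s_\lambda(x_1,\ldots,x_n)$ is the Schur polynomial. For a partition $\lambda$ with conjugate $\lambda'$ and Durfee square side $l=\max\{i:\lambda_i\ge i\}$, its Frobenius notation is $(\lambda_1-1,\ldots,\lambda_l-l\mid \lambda'_1-1,\ldots,\lambda'_l-l)$ (the empty partition is $(\,\mid\,)$). A plane partition inside an $(m,m,m)$-box is an array $(T_{i,j})_{1\le i,j\le m}$ of integers in $\{0,\ldots,m\}$ weakly decreasing along rows and columns; equivalently the set $\{(i,j,k): k\le T_{i,j}\}\subseteq\{1,\ldots,m\}^3$. It is totally symmetric if this set is invariant under all permutations of coordinates. $\mathrm{TSPP}_m$ is the set of totally symmetric plane partitions inside an $(m,m,m)$-box ($\mathrm{TSPP}_0$ consists of the empty one). For $T\in\mathrm{TSPP}_{n-1}$, $\mathrm{diag}(T)$ is the conjugate of the partition $(T_{1,1},T_{2,2},\ldots,T_{n-1,n-1})$; if $\mathrm{diag}(T)=(a_1,\ldots,a_l\mid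 b_1,\ldots,b_l)$ in Frobenius notation then $\pi(T)$ is the partition with Frobenius notation $(a_1,\ldots,a_l\mid b_1+1,\ldots,b_l+1)$. *)

theory Defs
  imports "HOL-Combinatorics.Permutations"
begin

text \<open>Partitions are represented as functions lam :: nat => nat, where lam i is the
  i-th part (i >= 1); lam 0 is irrelevant, and parts beyond the length are 0.\<close>

definition conj_part :: "(nat \<Rightarrow> nat) \<Rightarrow> nat \<Rightarrow> nat" where
  "conj_part lam j = card {i. 1 \<le> i \<and> j \<le> lam i}"

definition durfee :: "(nat \<Rightarrow> nat) \<Rightarrow> nat" where
  "durfee lam = card {i. 1 \<le> i \<and> i \<le> lam i}"

definition frob_a :: "(nat \<Rightarrow> nat) \<Rightarrow> nat \<Rightarrow> nat" where
  "frob_a lam i = lam i - i"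

definition frob_b :: "(nat \<Rightarrow> nat) \<Rightarrow> nat \<Rightarrow> nat" where
  "frob_b lam i = conj_part lam i - i"

text \<open>The partition with Frobenius notation (a_1,...,a_l | b_1,...,b_l):
  rows 1..l have length a_i + i; a row i > l has length #{j <= l. b_j + j >= i}
  (the column lengths of the first l columns are b_j + j).\<close>
definition frob_part :: "nat \<Rightarrow> (nat \<Rightarrow> nat) \<Rightarrow> (nat \<Rightarrow> nat) \<Rightarrow> nat \<Rightarrow> nat" where
  "frob_part l a b i =
     (if i = 0 then 0
      else if i \<le> l then a i + i
      else card {j \<in> {1..l}. i \<le> b j + j})"

definition pp_set :: "nat \<Rightarrow> (nat \<Rightarrow> nat \<Rightarrow> nat) \<Rightarrow> (nat \<times> nat \<times> nat) set" where
  "pp_set m T = {(i, j, k). i \<in> {1..m} \<and> j \<in> {1..m} \<and> 1 \<le> k \<and> k \<le> T i j}"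

definition TSPP :: "nat \<Rightarrow> (nat \<Rightarrow> nat \<Rightarrow> nat) set" where
  "TSPP m = {T.
     (\<forall>i j. T i j \<le> m)
   \<and> (\<forall>i j. \<not> (i \<in> {1..m} \<and> j \<in> {1..m}) \<longrightarrow> T i j = 0)
   \<and> (\<forall>i j. i \<in> {1..m} \<and> j \<in> {1..m} \<and> j + 1 \<le> m \<longrightarrow> T i (j + 1) \<le> T i j)
   \<and> (\<forall>i j. i \<in> {1..m} \<and> j \<in> {1..m} \<and> i + 1 \<le> m \<longrightarrow> T (i + 1) j \<le> T i j)
   \<and> (\<forall>i j k. (i, j, k) \<in> pp_set m T \<longrightarrow>
        (j, i, k) \<in> pp_set m T \<and> (i, k, j) \<in> pp_set m T \<and> (k, j, i) \<in> pp_set m T \<and>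
        (j, k, i) \<in> pp_set m T \<and> (k, i, j) \<in> pp_set m T)}"

definition diag_part :: "nat \<Rightarrow> (nat \<Rightarrow> nat \<Rightarrow> nat) \<Rightarrow> nat \<Rightarrow> nat" where
  "diag_part m T = conj_part (\<lambda>i. if i \<in> {1..m} then T i i else 0)"

definition pi_part :: "nat \<Rightarrow> (nat \<Rightarrow> nat \<Rightarrow> nat) \<Rightarrow> nat \<Rightarrow> nat" where
  "pi_part m T =
     (let d = diag_part m T
      in frob_part (durfee d) (frob_a d) (\<lambda>i. frob_b d i + 1))"

definition omega :: "nat \<Rightarrow> (nat \<Rightarrow> nat) \<Rightarrow> 'a::comm_ring_1 \<Rightarrow> 'a \<Rightarrow> 'a" where
  "omega n mu u v =
     (let l = durfee mu; a = frob_a mu; c = frob_b mu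
      in u ^ (\<Sum>i=1..l. a i + 1)
         * (1 - u - v) ^ (\<Sum>i=1..l. c i - 1 - a i)
         * v ^ ((n choose 2) - (\<Sum>i=1..l. c i)))"

definition young_cells :: "(nat \<Rightarrow> nat) \<Rightarrow> (nat \<times> nat) set" where
  "young_cells lam = {(i, j). 1 \<le> i \<and> 1 \<le> j \<and> j \<le> lam i}"

definition ssyt :: "(nat \<Rightarrow> nat) \<Rightarrow> nat \<Rightarrow> (nat \<Rightarrow> nat \<Rightarrow> nat) set" where
  "ssyt lam n = {t.
     (\<forall>i j. (i, j) \<in> young_cells lam \<longrightarrow> t i j \<in> {1..n})
   \<and> (\<forall>i j. (i, j) \<notin> young_cells lam \<longrightarrow> t i j = 0)
   \<and> (\<forall>i j. (i, j) \<in> young_cells lam \<and> (i, j + 1) \<in> young_cells lam \<longrightarrow> t i j \<le> t i (j + 1))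
   \<and> (\<forall>i j. (i, j) \<in> young_cells lam \<and> (i + 1, j) \<in> young_cells lam \<longrightarrow> t i j < t (i + 1) j)}"

definition schur :: "(nat \<Rightarrow> nat) \<Rightarrow> nat \<Rightarrow> (nat \<Rightarrow> 'a::comm_ring_1) \<Rightarrow> 'a" where
  "schur lam n x = (\<Sum>t\<in>ssyt lam n. \<Prod>(i, j)\<in>young_cells lam. x (t i j))"

definition asym :: "nat \<Rightarrow> ((nat \<Rightarrow> 'a::comm_ring_1) \<Rightarrow> 'a) \<Rightarrow> (nat \<Rightarrow> 'a) \<Rightarrow> 'a" where
  "asym n F x = (\<Sum>\<sigma> | \<sigma> permutes {1..n}. of_int (sign \<sigma>) * F (\<lambda>i. x (\<sigma> i)))"

definition A_summand :: "'a::comm_ring_1 \<Rightarrow> 'a \<Rightarrow> nat \<Rightarrow> (nat \<Rightarrow> 'a) \<Rightarrow> 'a" where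
  "A_summand u v n y =
     (\<Prod>i=1..n. y i ^ (i - 1)) *
     (\<Prod>i=1..n. \<Prod>j\<in>{i<..n}. v + (1 - u - v) * y i + u * y i * y j)"

definition vandermonde :: "nat \<Rightarrow> (nat \<Rightarrow> 'a::comm_ring_1) \<Rightarrow> 'a" where
  "vandermonde n x = (\<Prod>i=1..n. \<Prod>j\<in>{i<..n}. x j - x i)"

end

theory Submission
  imports Defs "HOL-Library.FuncSet"
begin

text \<open>Write \<open>w = 1 - u - v\<close>. Expanding the antisymmetrizer along the variable in its first position and
  using the generating function of the elementary symmetric functions of \<open>w + u * x j\<close>, one finds
  by induction that it equals, up to reversal of the variables, the determinant with columns
  \<open>v ^ c * t ^ (n - 1 - c) + (- 1) ^ c * u * t ^ n * (w + u * t) ^ (c - 1)\<close> for \<open>0 < c < n\<close>, and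
  \<open>t ^ (n - 1)\<close> for \<open>c = 0\<close>, evaluated at the variables.

  Choosing the second summand exactly in the columns \<open>c 1 > \<dots> > c l\<close> and there the power
  \<open>t ^ (n + a i)\<close> gives, after sorting, the alternant whose quotient by the Vandermonde determinant
  is the Schur polynomial of the partition \<open>(a | c)\<close>; the signs \<open>(- 1) ^ c i\<close> cancel against the
  sign of the sorting. Its coefficient is a determinant of binomial coefficients, which counts the
  totally symmetric plane partitions with the corresponding diagonal. This count is obtained
  one step of Pascal's recursion at a time: a totally symmetric plane partition is determined by
  its cells with \<open>i \<le> p \<le> q\<close>, that is by a shifted array with strictly decreasing rows and weakly
  decreasing columns, and subtracting 1 from all entries of the array corresponds to one step.
  The passage from tableaux to alternants is the usual branching rule, which removes the
  largest entry of the tableaux and, on the other side, the last variable.\<close>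

text \<open>The denominator is cleared and the ring is an arbitrary commutative one, so no step
  divides by a difference of variables.

  The obstacle to a determinant is that the expansion leaves a product over the variables other than
  \<open>x k\<close>, whose coefficients vary with \<open>k\<close>, while a column must be one
  function evaluated at every variable. Symmetric functions of the other variables are therefore
  traded for those of all variables, at the price of complete homogeneous polynomials; triangular
  column operations remove these again.

  The binomial determinants that count plane partitions are never written down. With arbitrary
  functions \<open>f a\<close> in place of powers of \<open>t\<close>, a Pascal step replaces
  \<open>f a\<close> by \<open>w * f a + u * f (Suc a)\<close>, so counting and expansion share one
  induction, and the sorting sign appears one column at a time.\<close>

section \<open>Downward closed sets of numbers\<close>

lemma nat_eqI_pos_le:
  assumes "\<And>i. 1 \<le> i \<Longrightarrow> i \<le> a \<longleftrightarrow> i \<le> b"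
  shows "a = (b::nat)"
  using assms[of a] assms[of b] by (cases "a = 0"; cases "b = 0") auto

text \<open>Row lengths, conjugate parts and the entries of a rebuilt plane partition are defined as
  cardinalities. For sets closed downwards the cardinality decides membership, which is how all of
  them are evaluated.\<close>

lemma interval_eq:
  fixes J :: "nat set"
  assumes "finite J" "\<And>j. j \<in> J \<Longrightarrow> b \<le> j" "\<And>j. b \<le> j \<Longrightarrow> Suc j \<in> J \<Longrightarrow> j \<in> J"
  shows "J = {b..<b + card J}"
proof (cases "J = {}")
  case False
  define M where "M = Max J"
  have M: "M \<in> J" "\<And>j. j \<in> J \<Longrightarrow> j \<le> M" using assms(1) False by (simp_all add: M_def)
  have down: "j \<in> J" if "b \<le> j" "j \<le> M" for j
    using that(2,1) by (induction rule: inc_induct) (auto intro: assms(3) M)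
  have J: "J = {b..<Suc M}"
    by (rule set_eqI) (meson M(2) assms(2) atLeastLessThan_iff down less_Suc_eq_le)
  moreover have "b \<le> M" using M(1) by (rule assms(2))
  ultimately have "card J = Suc M - b" by simp
  then show ?thesis using J \<open>b \<le> M\<close> by simp
qed simp

lemma initial_segment_eq:
  fixes J :: "nat set"
  assumes "finite J" "0 \<notin> J" "\<And>j. 1 \<le> j \<Longrightarrow> Suc j \<in> J \<Longrightarrow> j \<in> J"
  shows "J = {1..card J}"
proof -
  have pos: "1 \<le> j" if "j \<in> J" for j using that assms(2) by (cases j) auto
  have "J = {1..<1 + card J}" by (rule interval_eq[OF assms(1) pos assms(3)])
  then show ?thesis by (simp add: atLeastLessThanSuc_atLeastAtMost)
qed

subsection \<open>Antisymmetrizers and alternants\<close>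

lemma sign_compose_permutes:
  "p permutes {1..n} \<Longrightarrow> q permutes {1..n} \<Longrightarrow> sign (p \<circ> q) = sign p * sign (q :: nat \<Rightarrow> nat)"
  by (meson finite_atLeastAtMost permutation_permutes sign_compose)

lemma asym_compose_arg:
  assumes "\<pi> permutes {1..n}"
  shows "asym n (\<lambda>y. F (\<lambda>i. y (\<pi> i))) x = of_int (sign \<pi>) * asym n F x"
proof -
  have "asym n F x = (\<Sum>\<sigma> | \<sigma> permutes {1..n}. of_int (sign (\<sigma> \<circ> \<pi>)) * F (\<lambda>i. x ((\<sigma> \<circ> \<pi>) i)))"
    unfolding asym_def by (rule sum_permutations_compose_right[OF assms])
  also have "\<dots> = of_int (sign \<pi>) * (\<Sum>\<sigma> | \<sigma> permutes {1..n}. of_int (sign \<sigma>) * F (\<lambda>i. x (\<sigma> (\<pi> i))))"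
    unfolding sum_distrib_left
    by (rule sum.cong) (use assms in \<open>simp_all add: sign_compose_permutes algebra_simps del: One_nat_def\<close>)
  finally have "of_int (sign \<pi>) * asym n F x = of_int (sign \<pi> * sign \<pi>) *
      (\<Sum>\<sigma> | \<sigma> permutes {1..n}. of_int (sign \<sigma>) * F (\<lambda>i. x (\<sigma> (\<pi> i))))"
    by (simp only: mult.assoc of_int_mult)
  then show ?thesis by (simp add: asym_def)
qed

lemma asym_compose_var:
  assumes "\<pi> permutes {1..n}"
  shows "asym n F (\<lambda>i. x (\<pi> i)) = of_int (sign \<pi>) * asym n F x"
proof -
  have "asym n F x = (\<Sum>\<sigma> | \<sigma> permutes {1..n}. of_int (sign (\<pi> \<circ> \<sigma>)) * F (\<lambda>i. x ((\<pi> \<circ> \<sigma>) i)))"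
    unfolding asym_def by (rule setum_permutations_compose_left[OF assms])
  also have "\<dots> = of_int (sign \<pi>) * asym n F (\<lambda>i. x (\<pi> i))"
    unfolding sum_distrib_left asym_def
    by (rule sum.cong) (use assms in \<open>simp_all add: sign_compose_permutes algebra_simps del: One_nat_def\<close>)
  finally have "of_int (sign \<pi>) * asym n F x = of_int (sign \<pi> * sign \<pi>) * asym n F (\<lambda>i. x (\<pi> i))"
    by (simp only: mult.assoc of_int_mult)
  then show ?thesis by simp
qed

text \<open>Left cosets of the permutations fixing \<open>Suc n\<close>, represented by
  transpositions. These give the sign \<open>- 1\<close> for every \<open>k \<noteq> Suc n\<close>;
  in exchange \<open>x (Suc n)\<close> takes position \<open>k\<close> among the remaining
  variables.\<close>

lemma asym_Suc:
  "asym (Suc n) F x = (\<Sum>k=1..Suc n. (if k = Suc n then 1 else - 1) *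
     asym n (\<lambda>y. F (y(Suc n := x k))) (\<lambda>i. x (transpose (Suc n) k i)))"
proof -
  have set: "{1..Suc n} = insert (Suc n) {1..n}" by auto
  have *: "of_int (sign (transpose (Suc n) k \<circ> \<tau>)) * F (\<lambda>i. x ((transpose (Suc n) k \<circ> \<tau>) i))
     = (if k = Suc n then 1 else - 1) *
        (of_int (sign \<tau>) * F ((\<lambda>i. x (transpose (Suc n) k (\<tau> i)))(Suc n := x k)))"
    if "\<tau> permutes {1..n}" for \<tau> k
  proof -
    have "\<tau> (Suc n) = Suc n" using that by (auto simp: permutes_def)
    then have "(\<lambda>i. x ((transpose (Suc n) k \<circ> \<tau>) i)) =
      (\<lambda>i. x (transpose (Suc n) k (\<tau> i)))(Suc n := x k)"
      by auto
    moreover have "permutation \<tau>" using that permutation_permutes by blast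
    ultimately show ?thesis
      by (simp add: sign_compose sign_swap_id permutation_swap_id)
  qed
  show ?thesis
    unfolding asym_def set
    by (subst sum_over_permutations_insert)
       (auto simp: * sum_distrib_left simp del: One_nat_def sum.insert o_apply intro!: sum.cong)
qed

text \<open>The determinant with entries \<open>g i (x k)\<close>. Columns are functions, so column
  operations become identities between functions.\<close>

definition alternant :: "nat \<Rightarrow> (nat \<Rightarrow> 'a \<Rightarrow> 'a) \<Rightarrow> (nat \<Rightarrow> 'a::comm_ring_1) \<Rightarrow> 'a" where
  "alternant n g = asym n (\<lambda>y. \<Prod>i=1..n. g i (y i))"

lemma alternant_cong:
  assumes "\<And>i k. i \<in> {1..n} \<Longrightarrow> k \<in> {1..n} \<Longrightarrow> g i (x k) = h i (x k)"
  shows "alternant n g x = alternant n h x"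
  unfolding alternant_def asym_def
  by (intro sum.cong refl arg_cong2[where f="(*)"] prod.cong)
     (auto intro!: assms dest: permutes_in_image simp del: atLeastAtMost_iff)

lemma alternant_0 [simp]: "alternant 0 g x = 1"
  by (simp add: alternant_def asym_def)

lemma alternant_permute_columns:
  assumes "\<pi> permutes {1..n}"
  shows "alternant n (\<lambda>i. g (\<pi> i)) x = of_int (sign \<pi>) * alternant n g x"
proof -
  have inv: "inv \<pi> permutes {1..n}" using assms by (rule permutes_inv)
  have "(\<Prod>i=1..n. g (\<pi> i) (y i)) = (\<Prod>i=1..n. g i (y (inv \<pi> i)))" for y
    using prod.permute[OF inv, of "\<lambda>i. g (\<pi> i) (y i)"]
    by (simp add: o_def permutes_inverses[OF assms])
  moreover have "sign (inv \<pi>) = sign \<pi>"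
    using assms permutation_permutes sign_inverse by blast
  ultimately show ?thesis
    using asym_compose_arg[OF inv, of "\<lambda>y. \<Prod>i=1..n. g i (y i)" x] by (simp add: alternant_def)
qed

lemma alternant_Suc:
  "alternant (Suc n) g x = (\<Sum>k=1..Suc n. (if k = Suc n then 1 else - 1) *
     (g (Suc n) (x k) * alternant n g (\<lambda>i. x (transpose (Suc n) k i))))"
proof -
  have "asym n (\<lambda>y. \<Prod>i=1..Suc n. g i ((y(Suc n := z)) i)) x' = g (Suc n) z * alternant n g x'" for z x'
    unfolding alternant_def asym_def sum_distrib_left
    by (intro sum.cong refl) (simp add: algebra_simps)
  then show ?thesis unfolding alternant_def[of "Suc n"] asym_Suc by simp
qed

text \<open>Exchanging the columns only shows D = - D, which is not enough where 2 is a zero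
  divisor. Hence the even permutations are matched with the odd ones by composing with the
  transposition.\<close>

lemma alternant_eq_columns:
  assumes "i \<in> {1..n}" "j \<in> {1..n}" "i \<noteq> j" "g i = g j"
  shows "alternant n g x = 0"
proof -
  define P where "P \<sigma> = (\<Prod>k=1..n. g k (x (\<sigma> k)))" for \<sigma>
  define \<tau> where "\<tau> = transpose i j"
  have \<tau>: "\<tau> permutes {1..n}" unfolding \<tau>_def by (rule permutes_swap_id) fact+
  have perm: "permutation \<sigma>" if "\<sigma> permutes {1..n}" for \<sigma>
    using that permutation_permutes by blast
  have sgn: "sign (\<sigma> \<circ> \<tau>) = - sign \<sigma>" if "\<sigma> permutes {1..n}" for \<sigma>
    using perm[OF that] perm[OF \<tau>] assms(3) by (simp add: sign_compose \<tau>_def sign_swap_id)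
  have inv: "\<tau> \<circ> \<tau> = id" by (simp add: \<tau>_def fun_eq_iff)
  have P: "P (\<sigma> \<circ> \<tau>) = P \<sigma>" for \<sigma>
  proof -
    have "g (\<tau> k) = g k" for k using assms(4) by (auto simp: \<tau>_def transpose_def)
    then show ?thesis
      using prod.permute[OF \<tau>, of "\<lambda>k. g k (x (\<sigma> k))"] unfolding P_def by (simp add: o_def)
  qed
  let ?E = "{\<sigma>. \<sigma> permutes {1..n} \<and> sign \<sigma> = 1}" and ?O = "{\<sigma>. \<sigma> permutes {1..n} \<and> sign \<sigma> = - 1}"
  have fin: "finite {\<sigma>. \<sigma> permutes {1..n}}" by (rule finite_permutations) simp
  have split: "{\<sigma>. \<sigma> permutes {1..n}} = ?E \<union> ?O" by (auto simp: sign_def)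
  have "sum P ?O = sum P ?E"
  proof (rule sum.reindex_bij_witness[where i="\<lambda>\<sigma>. \<sigma> \<circ> \<tau>" and j="\<lambda>\<sigma>. \<sigma> \<circ> \<tau>"])
    fix \<sigma> assume "\<sigma> \<in> ?O"
    then show "\<sigma> \<circ> \<tau> \<in> ?E" using \<tau> by (auto simp: sgn permutes_compose)
  next
    fix \<sigma> assume "\<sigma> \<in> ?E"
    then show "\<sigma> \<circ> \<tau> \<in> ?O" using \<tau> by (auto simp: sgn permutes_compose)
  qed (simp_all add: comp_assoc inv P)
  moreover have "alternant n g x = (\<Sum>\<sigma>\<in>?E \<union> ?O. of_int (sign \<sigma>) * P \<sigma>)"
    unfolding alternant_def asym_def split[symmetric] P_def ..
  moreover have "\<dots> = (\<Sum>\<sigma>\<in>?E. of_int (sign \<sigma>) * P \<sigma>) + (\<Sum>\<sigma>\<in>?O. of_int (sign \<sigma>) * P \<sigma>)"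
    by (rule sum.union_disjoint) (use fin in \<open>auto simp: split\<close>)
  moreover have "\<dots> = sum P ?E - sum P ?O" by (simp add: sum_negf)
  ultimately show ?thesis by simp
qed

lemma alternant_scale_rows:
  "(\<Prod>i=1..n. c (x i)) * alternant n g x = alternant n (\<lambda>i t. c t * g i t) x"
proof -
  have "(\<Prod>i=1..n. c (x i)) = (\<Prod>i=1..n. c (x (\<sigma> i)))" if "\<sigma> permutes {1..n}" for \<sigma>
    using prod.permute[OF that, of "\<lambda>i. c (x i)"] by (simp add: o_def)
  then show ?thesis unfolding alternant_def asym_def sum_distrib_left
    by (intro sum.cong refl) (simp add: prod.distrib algebra_simps)
qed

lemma alternant_column_sum:
  assumes "finite K" "j \<in> {1..n}"
  shows "alternant n (g(j := \<lambda>t. \<Sum>k\<in>K. c k * f k t)) x = (\<Sum>k\<in>K. c k * alternant n (g(j := f k)) x)"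
proof -
  have *: "(\<Prod>i=1..n. (g(j := h)) i (y i)) = h (y j) * (\<Prod>i\<in>{1..n}-{j}. g i (y i))" for h y
    using assms(2) by (subst prod.remove[of _ j]) (auto intro!: prod.cong arg_cong2[where f="(*)"])
  have "alternant n (g(j := \<lambda>t. \<Sum>k\<in>K. c k * f k t)) x =
    (\<Sum>\<sigma> | \<sigma> permutes {1..n}. \<Sum>k\<in>K. c k * (of_int (sign \<sigma>) * (f k (x (\<sigma> j)) * (\<Prod>i\<in>{1..n}-{j}. g i (x (\<sigma> i))))))"
    unfolding alternant_def asym_def *
    by (intro sum.cong refl) (simp add: sum_distrib_left sum_distrib_right algebra_simps)
  also have "\<dots> = (\<Sum>k\<in>K. c k * alternant n (g(j := f k)) x)"
    unfolding alternant_def asym_def * by (subst sum.swap) (simp add: sum_distrib_left)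
  finally show ?thesis .
qed

subsection \<open>The antisymmetrizer as a determinant\<close>

definition elem_sym :: "nat \<Rightarrow> nat set \<Rightarrow> (nat \<Rightarrow> 'a::comm_ring_1) \<Rightarrow> 'a" where
  "elem_sym d J q = (\<Sum>S | S \<subseteq> J \<and> card S = d. \<Prod>j\<in>S. q j)"

lemma elem_sym_0 [simp]: "finite J \<Longrightarrow> elem_sym 0 J q = 1"
proof -
  assume "finite J"
  then have "{S. S \<subseteq> J \<and> card S = 0} = {{}}" by (auto dest: finite_subset)
  then show ?thesis by (simp add: elem_sym_def)
qed

lemma elem_sym_insert:
  assumes "finite J" "k \<notin> J"
  shows "elem_sym (Suc d) (insert k J) q = elem_sym (Suc d) J q + q k * elem_sym d J q"
proof -
  have 1: "{S. S \<subseteq> insert k J \<and> card S = Suc d} =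
    {S. S \<subseteq> J \<and> card S = Suc d} \<union> insert k ` {S. S \<subseteq> J \<and> card S = d}" (is "?L = ?A \<union> ?B")
  proof (intro subset_antisym subsetI)
    fix S assume S: "S \<in> ?L"
    show "S \<in> ?A \<union> ?B"
    proof (cases "k \<in> S")
      case True
      then have "S = insert k (S - {k})" "S - {k} \<subseteq> J" "card (S - {k}) = d"
        using S assms finite_subset[of S "insert k J"] by auto
      then show ?thesis by blast
    qed (use S in auto)
  next
    fix S assume "S \<in> ?A \<union> ?B"
    moreover have "card (insert k S') = Suc (card S')" if "S' \<subseteq> J" for S'
      using that assms finite_subset by (subst card_insert_disjoint) auto
    ultimately show "S \<in> ?L" by auto
  qed
  have inj: "inj_on (insert k) {S. S \<subseteq> J \<and> card S = d}"
    using assms by (auto simp: inj_on_def dest!: insert_ident[THEN iffD1, rotated -1])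
  have "(\<Prod>j\<in>insert k S. q j) = q k * (\<Prod>j\<in>S. q j)" if "S \<subseteq> J" for S
    using that assms finite_subset by (subst prod.insert) auto
  then have "(\<Sum>S\<in>?B. \<Prod>j\<in>S. q j) = q k * elem_sym d J q"
    by (subst sum.reindex[OF inj]) (simp add: elem_sym_def sum_distrib_left)
  moreover have "(\<Sum>S\<in>?A \<union> ?B. \<Prod>j\<in>S. q j) = (\<Sum>S\<in>?A. \<Prod>j\<in>S. q j) + (\<Sum>S\<in>?B. \<Prod>j\<in>S. q j)"
    by (rule sum.union_disjoint) (use assms in auto)
  ultimately show ?thesis unfolding 1 elem_sym_def by simp
qed

lemma elem_sym_gt_card: "finite J \<Longrightarrow> card J < d \<Longrightarrow> elem_sym d J q = 0"
  unfolding elem_sym_def by (rule sum.neutral) (auto dest: card_mono)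

text \<open>The truncation degree is not tied to \<open>card J\<close>; this freedom allows the
  induction on \<open>m\<close> in \<open>sum_elem_sym_hom2\<close>.\<close>

lemma sum_elem_sym_insert:
  assumes "finite J" "k \<notin> J"
  shows "(\<Sum>d\<le>Suc m. elem_sym d (insert k J) q * z ^ d * v ^ (Suc m - d)) =
    (\<Sum>d\<le>Suc m. elem_sym d J q * z ^ d * v ^ (Suc m - d)) + z * q k * (\<Sum>d\<le>m. elem_sym d J q * z ^ d * v ^ (m - d))"
  unfolding sum.atMost_Suc_shift[of _ m]
  by (simp add: assms elem_sym_insert algebra_simps sum.distrib sum_distrib_left)

lemma prod_affine_elem_sym:
  assumes "finite J"
  shows "(\<Prod>j\<in>J. v + z * q j) = (\<Sum>d\<le>card J. elem_sym d J q * z ^ d * v ^ (card J - d))"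
  using assms
proof (induction J rule: finite_induct)
  case (insert k J)
  have "(\<Sum>d\<le>Suc (card J). elem_sym d J q * z ^ d * v ^ (Suc (card J) - d)) =
      v * (\<Sum>d\<le>card J. elem_sym d J q * z ^ d * v ^ (card J - d))"
    using insert.hyps by (simp add: elem_sym_gt_card Suc_diff_le algebra_simps sum_distrib_left)
  then have "(\<Sum>d\<le>Suc (card J). elem_sym d (insert k J) q * z ^ d * v ^ (Suc (card J) - d)) =
      (v + z * q k) * (\<Sum>d\<le>card J. elem_sym d J q * z ^ d * v ^ (card J - d))"
    unfolding sum_elem_sym_insert[OF insert.hyps] by (simp only: distrib_right)
  then show ?case
    using insert by (simp del: sum.atMost_Suc)
qed simp

text \<open>The complete homogeneous symmetric polynomial of degree \<open>c\<close> in two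
  variables.\<close>

definition hom2 :: "nat \<Rightarrow> 'a::comm_ring_1 \<Rightarrow> 'a \<Rightarrow> 'a" where
  "hom2 c a b = (\<Sum>r\<le>c. a ^ (c - r) * b ^ r)"

lemma hom2_0 [simp]: "hom2 0 a b = 1"
  by (simp add: hom2_def)

lemma hom2_Suc_left: "hom2 (Suc c) a b = a ^ Suc c + b * hom2 c a b"
  unfolding hom2_def sum.atMost_Suc_shift by (simp add: sum_distrib_left algebra_simps)

lemma hom2_Suc_right: "hom2 (Suc c) a b = a * hom2 c a b + b ^ Suc c"
  unfolding hom2_def sum.atMost_Suc by (simp add: sum_distrib_left Suc_diff_le algebra_simps)

text \<open>The point is that the coefficients on the left depend only on \<open>insert k J\<close>: this expresses
  the product of \<open>v + z * q j\<close> over \<open>j \<noteq> k\<close> through functions of \<open>z\<close> and \<open>q k\<close>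
  with coefficients that are the same for every \<open>k\<close>.\<close>

lemma sum_elem_sym_hom2:
  assumes "finite J" "k \<notin> J"
  shows "(\<Sum>d\<le>m. elem_sym d (insert k J) q * z ^ d * hom2 (m - d) v (- (z * q k))) =
    (\<Sum>d\<le>m. elem_sym d J q * z ^ d * v ^ (m - d))"
proof (induction m)
  case 0
  then show ?case using assms by simp
next
  case (Suc m)
  let ?e = "\<lambda>d. elem_sym d (insert k J) q * z ^ d"
  have "(\<Sum>d\<le>Suc m. ?e d * hom2 (Suc m - d) v (- (z * q k)))
     = (\<Sum>d\<le>m. ?e d * v ^ (Suc m - d) - z * q k * (?e d * hom2 (m - d) v (- (z * q k)))) + ?e (Suc m)"
    by (simp add: Suc_diff_le hom2_Suc_left algebra_simps)
  also have "\<dots> = (\<Sum>d\<le>Suc m. ?e d * v ^ (Suc m - d)) - z * q k * (\<Sum>d\<le>m. ?e d * hom2 (m - d) v (- (z * q k)))"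
    by (simp add: sum_subtractf sum_distrib_left)
  also have "\<dots> = (\<Sum>d\<le>Suc m. elem_sym d J q * z ^ d * v ^ (Suc m - d))"
    unfolding Suc sum_elem_sym_insert[OF assms] by simp
  finally show ?case .
qed

section \<open>Columns of the determinant\<close>

text \<open>The function of \<open>t = x k\<close> that accompanies the elementary symmetric
  function of degree \<open>N - c\<close> in \<open>sum_elem_sym_hom2\<close>, for
  \<open>z = t\<close> and \<open>q k = w + u * t\<close>.\<close>

definition kcol :: "'a::comm_ring_1 \<Rightarrow> 'a \<Rightarrow> 'a \<Rightarrow> nat \<Rightarrow> nat \<Rightarrow> 'a \<Rightarrow> 'a" where
  "kcol u v w N c t = t ^ (N - c) * hom2 c v (- (t * (w + u * t)))"

text \<open>The case \<open>c = 0\<close> is separate because truncation of \<open>c - 1\<close>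
  would leave a spurious summand \<open>u * t ^ Suc N\<close>.\<close>

definition tcol :: "'a::comm_ring_1 \<Rightarrow> 'a \<Rightarrow> 'a \<Rightarrow> nat \<Rightarrow> nat \<Rightarrow> 'a \<Rightarrow> 'a" where
  "tcol u v w N c t = v ^ c * t ^ (N - c) +
     (if c = 0 then 0 else (- 1) ^ c * (u * t ^ Suc N * (w + u * t) ^ (c - 1)))"

lemma tcol_Suc: "c \<le> N \<Longrightarrow> tcol u v w (Suc N) c t = t * tcol u v w N c t"
  by (simp add: tcol_def Suc_diff_le algebra_simps)

text \<open>The coefficients come from \<open>b = - (t * (w + u * t))\<close>: the left recursion of
  \<open>hom2\<close> leaves the factor \<open>b + w * t = - u * t^2\<close>, and with the term
  \<open>u * v\<close> the right recursion reduces the rest to the single power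
  \<open>b ^ Suc c\<close>.\<close>

lemma tcol_eq_kcol:
  assumes "Suc (Suc c) \<le> N"
  shows "tcol u v w N (Suc (Suc c)) t =
    kcol u v w N (Suc (Suc c)) t + w * kcol u v w N (Suc c) t + u * v * kcol u v w N c t"
proof -
  define b where "b = - (t * (w + u * t))"
  obtain M where N: "N = Suc (Suc (c + M))"
    using assms by (metis add_Suc less_eqE)
  have 1: "hom2 (Suc (Suc c)) v b = v ^ Suc (Suc c) + b * hom2 (Suc c) v b" by (rule hom2_Suc_left)
  have 2: "hom2 (Suc c) v b = v * hom2 c v b + b ^ Suc c" by (rule hom2_Suc_right)
  have "hom2 (Suc (Suc c)) v b + w * t * hom2 (Suc c) v b + u * v * t^2 * hom2 c v b
      = v ^ Suc (Suc c) - u * t^2 * (hom2 (Suc c) v b - v * hom2 c v b)"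
    unfolding 1 by (simp add: b_def algebra_simps power2_eq_square)
  also have "\<dots> = v ^ Suc (Suc c) - u * t^2 * b ^ Suc c" using 2 by simp
  finally have *: "hom2 (Suc (Suc c)) v b + w * t * hom2 (Suc c) v b + u * v * t^2 * hom2 c v b =
    v ^ Suc (Suc c) - u * t^2 * b ^ Suc c" .
  have "kcol u v w N (Suc (Suc c)) t + w * kcol u v w N (Suc c) t + u * v * kcol u v w N c t =
     t ^ M * (hom2 (Suc (Suc c)) v b + w * t * hom2 (Suc c) v b + u * v * t^2 * hom2 c v b)"
    unfolding kcol_def b_def[symmetric] by (simp add: N algebra_simps power2_eq_square Suc_diff_le)
  also have "\<dots> = tcol u v w N (Suc (Suc c)) t"
  proof -
    have b: "b ^ Suc c = (- 1) ^ Suc c * (t ^ Suc c * (w + u * t) ^ Suc c)"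
      unfolding b_def power_minus[of "t * _"] power_mult_distrib ..
    show ?thesis
      unfolding * b by (simp add: tcol_def N algebra_simps power_add power2_eq_square)
  qed
  finally show ?thesis ..
qed

text \<open>Unitriangular, with coefficients free of \<open>t\<close>, by solving the three-term
  relation for its leading \<open>kcol\<close>. The relation reaches two steps back, hence the two
  base cases.\<close>

lemma kcol_in_span_tcol:
  "c \<le> N \<Longrightarrow> \<exists>\<gamma>. \<forall>t. kcol u v w N c t = tcol u v w N c t + (\<Sum>d<c. \<gamma> d * tcol u v w N d t)"
proof (induction c rule: less_induct)
  case (less c)
  consider "c = 0" | "c = 1" | c' where "c = Suc (Suc c')"
    by (metis One_nat_def not0_implies_Suc)
  then show ?case
  proof cases
    case 1
    then show ?thesis by (simp add: kcol_def tcol_def)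
  next
    case 2
    obtain M where N: "N = Suc M" using less.prems 2 by (cases N) auto
    have "\<forall>t. kcol u v w N c t = tcol u v w N c t + (\<Sum>d<c. (- w) * tcol u v w N d t)"
      using 2 by (simp add: kcol_def tcol_def N hom2_def algebra_simps)
    then show ?thesis by (rule exI[of _ "\<lambda>_. - w"])
  next
    case 3
    obtain \<gamma> where \<gamma>: "\<forall>t. kcol u v w N (Suc c') t = tcol u v w N (Suc c') t + (\<Sum>d<Suc c'. \<gamma> d * tcol u v w N d t)"
      using less.IH[of "Suc c'"] less.prems 3 by auto
    obtain \<delta> where \<delta>: "\<forall>t. kcol u v w N c' t = tcol u v w N c' t + (\<Sum>d<c'. \<delta> d * tcol u v w N d t)"
      using less.IH[of c'] less.prems 3 by auto
    define \<gamma>' where "\<gamma>' d = - w * (if d = Suc c' then 1 else \<gamma> d) - u * v * (if d = c' then 1 else if d < c' then \<delta> d else 0)" for d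
    have "kcol u v w N c t = tcol u v w N c t + (\<Sum>d<c. \<gamma>' d * tcol u v w N d t)" for t
    proof -
      have "kcol u v w N c t = tcol u v w N c t - w * kcol u v w N (Suc c') t - u * v * kcol u v w N c' t"
        using tcol_eq_kcol[of c' N u v w t] less.prems 3 by simp
      also have "\<dots> = tcol u v w N c t + (\<Sum>d<c. \<gamma>' d * tcol u v w N d t)"
        using \<gamma>[rule_format, of t] \<delta>[rule_format, of t]
        by (simp add: 3 \<gamma>'_def algebra_simps sum_distrib_left sum.distrib sum_negf sum_subtractf)
      finally show ?thesis .
    qed
    then show ?thesis by blast
  qed
qed

text \<open>\<open>A_summand\<close> with the variables in reverse order, so that expanding along the last position with
  \<open>asym_Suc\<close> splits off a product of the shape treated in \<open>sum_elem_sym_hom2\<close>.\<close>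

definition rev_summand :: "'a::comm_ring_1 \<Rightarrow> 'a \<Rightarrow> 'a \<Rightarrow> nat \<Rightarrow> (nat \<Rightarrow> 'a) \<Rightarrow> 'a" where
  "rev_summand u v w n y =
     (\<Prod>i=1..n. y i ^ (n - i)) * (\<Prod>i=1..n. \<Prod>j\<in>{1..<i}. v + w * y i + u * y i * y j)"

lemma rev_summand_Suc:
  "rev_summand u v w (Suc n) (y(Suc n := z)) =
    (\<Prod>j=1..n. y j * (v + z * (w + u * y j))) * rev_summand u v w n y"
proof -
  have "(\<Prod>i=1..n. y i ^ (Suc n - i)) = (\<Prod>i=1..n. y i) * (\<Prod>i=1..n. y i ^ (n - i))"
    unfolding prod.distrib[symmetric] by (intro prod.cong refl) (auto simp: Suc_diff_le)
  moreover have "(\<Prod>j=1..n. v + w * z + u * z * y j) = (\<Prod>j=1..n. v + z * (w + u * y j))"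
    by (simp add: algebra_simps)
  moreover have "(\<Prod>i=1..n. \<Prod>j\<in>{1..<i}. v + w * (y(Suc n := z)) i + u * (y(Suc n := z)) i * (y(Suc n := z)) j) =
    (\<Prod>i=1..n. \<Prod>j\<in>{1..<i}. v + w * y i + u * y i * y j)"
    by (intro prod.cong refl) auto
  ultimately show ?thesis
    by (simp add: rev_summand_def prod.distrib atLeastLessThanSuc_atLeastAtMost ac_simps)
qed

text \<open>One coefficient sequence serves all \<open>k\<close>, so the product is a single column
  evaluated at \<open>x k\<close>. The leading coefficient is 1 because only the elementary
  symmetric function of degree 0 reaches the index \<open>n\<close>.\<close>

lemma prod_affine_in_span_tcol:
  fixes u v w :: "'a::comm_ring_1" and x :: "nat \<Rightarrow> 'a"
  obtains \<gamma> where "\<And>k. k \<in> {1..Suc n} \<Longrightarrow>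
    (\<Prod>j\<in>{1..Suc n} - {k}. v + x k * (w + u * x j)) = tcol u v w n n (x k) + (\<Sum>c<n. \<gamma> c * tcol u v w n c (x k))"
proof -
  define E where "E d = elem_sym d {1..Suc n} (\<lambda>j. w + u * x j)" for d
  have prod: "(\<Prod>j\<in>{1..Suc n} - {k}. v + x k * (w + u * x j)) = (\<Sum>d\<le>n. E d * kcol u v w n (n - d) (x k))"
    if k: "k \<in> {1..Suc n}" for k
  proof -
    let ?J = "{1..Suc n} - {k}"
    have ins: "insert k ?J = {1..Suc n}" using k by auto
    have card: "card ?J = n" using k by simp
    have "(\<Prod>j\<in>?J. v + x k * (w + u * x j)) = (\<Sum>d\<le>n. E d * x k ^ d * hom2 (n - d) v (- (x k * (w + u * x k))))"
      using sum_elem_sym_hom2[of ?J k "\<lambda>j. w + u * x j" "x k" n v] prod_affine_elem_sym[of ?J v "x k" "\<lambda>j. w + u * x j"]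
      unfolding ins card E_def by simp
    also have "\<dots> = (\<Sum>d\<le>n. E d * kcol u v w n (n - d) (x k))"
      by (intro sum.cong refl) (simp add: kcol_def algebra_simps)
    finally show ?thesis .
  qed
  have "\<forall>c. \<exists>\<gamma>. c \<le> n \<longrightarrow> (\<forall>t. kcol u v w n c t = tcol u v w n c t + (\<Sum>d<c. \<gamma> d * tcol u v w n d t))"
    using kcol_in_span_tcol[of _ n u v w] by blast
  then obtain \<Gamma> where \<Gamma>: "\<And>c t. c \<le> n \<Longrightarrow> kcol u v w n c t = tcol u v w n c t + (\<Sum>d<c. \<Gamma> c d * tcol u v w n d t)"
    by metis
  define \<Gamma>' where "\<Gamma>' c d = (if d < c then \<Gamma> c d else if d = c then 1 else 0)" for c d
  have \<Gamma>': "kcol u v w n c t = (\<Sum>d<Suc n. \<Gamma>' c d * tcol u v w n d t)" if "c \<le> n" for c t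
  proof -
    have "(\<Sum>d<Suc n. \<Gamma>' c d * tcol u v w n d t) = (\<Sum>d<Suc c. \<Gamma>' c d * tcol u v w n d t)"
      by (rule sum.mono_neutral_right) (use that in \<open>auto simp: \<Gamma>'_def\<close>)
    then show ?thesis using \<Gamma>[OF that] by (simp add: \<Gamma>'_def)
  qed
  define \<gamma> where "\<gamma> c = (\<Sum>d\<le>n. E d * \<Gamma>' (n - d) c)" for c
  have "\<gamma> n = (\<Sum>d\<in>{0}. E d * \<Gamma>' (n - d) n)"
    unfolding \<gamma>_def by (rule sum.mono_neutral_right) (auto simp: \<Gamma>'_def)
  then have \<gamma>n: "\<gamma> n = 1" by (simp add: \<Gamma>'_def E_def)
  have "(\<Prod>j\<in>{1..Suc n} - {k}. v + x k * (w + u * x j)) = tcol u v w n n (x k) + (\<Sum>c<n. \<gamma> c * tcol u v w n c (x k))"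
    if k: "k \<in> {1..Suc n}" for k
  proof -
    have "(\<Prod>j\<in>{1..Suc n} - {k}. v + x k * (w + u * x j)) = (\<Sum>d\<le>n. \<Sum>c<Suc n. E d * \<Gamma>' (n - d) c * tcol u v w n c (x k))"
      unfolding prod[OF k] by (simp add: \<Gamma>' sum_distrib_left algebra_simps del: sum.lessThan_Suc)
    also have "\<dots> = (\<Sum>c<Suc n. \<gamma> c * tcol u v w n c (x k))"
      unfolding \<gamma>_def sum_distrib_right by (rule sum.swap)
    finally show ?thesis by (simp add: \<gamma>n)
  qed
  then show thesis by (rule that)
qed

text \<open>Splitting off the last position reproduces the expansion of a determinant along its last
  column. That column is the one from \<open>prod_affine_in_span_tcol\<close>; its lower terms
  repeat other columns and drop out.\<close>

lemma asym_rev_summand: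
  "asym n (rev_summand u v w n) x = alternant n (\<lambda>i. tcol u v w (n - 1) (i - 1)) x"
proof (induction n arbitrary: x)
  case 0
  show ?case by (simp add: asym_def alternant_def rev_summand_def)
next
  case (Suc n)
  let ?tr = "\<lambda>k i. transpose (Suc n) k i"
  let ?g = "\<lambda>i. tcol u v w n (i - 1)"
  let ?\<epsilon> = "\<lambda>k. if k = Suc n then 1 else - 1 :: 'a"
  obtain \<gamma> where \<gamma>: "\<And>k. k \<in> {1..Suc n} \<Longrightarrow>
    (\<Prod>j\<in>{1..Suc n} - {k}. v + x k * (w + u * x j)) = tcol u v w n n (x k) + (\<Sum>c<n. \<gamma> c * tcol u v w n c (x k))"
    using prod_affine_in_span_tcol[of n v x w u] by blast
  define q where "q = (\<lambda>t. tcol u v w n n t + (\<Sum>c<n. \<gamma> c * tcol u v w n c t))"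
  have step: "asym n (\<lambda>y. rev_summand u v w (Suc n) (y(Suc n := x k))) (\<lambda>i. x (?tr k i)) =
      q (x k) * alternant n ?g (\<lambda>i. x (?tr k i))" if k: "k \<in> {1..Suc n}" for k
  proof -
    let ?x = "\<lambda>i. x (?tr k i)"
    let ?c = "\<lambda>t. t * (v + x k * (w + u * t))"
    \<comment> \<open>The factor split off is symmetric in the remaining variables and therefore
      leaves the antisymmetrizer.\<close>
    have "asym n (\<lambda>y. rev_summand u v w (Suc n) (y(Suc n := x k))) ?x =
       (\<Prod>j=1..n. ?c (?x j)) * asym n (rev_summand u v w n) ?x"
    proof -
      have "(\<Prod>j=1..n. ?c (?x (\<sigma> j))) = (\<Prod>j=1..n. ?c (?x j))" if "\<sigma> permutes {1..n}" for \<sigma>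
        using prod.permute[OF that, of "\<lambda>j. ?c (?x j)"] by (simp add: o_def)
      then show ?thesis
        unfolding rev_summand_Suc asym_def sum_distrib_left
        by (intro sum.cong refl) (simp add: algebra_simps)
    qed
    also have "\<dots> = (\<Prod>j=1..n. v + x k * (w + u * ?x j)) * ((\<Prod>j=1..n. ?x j) * alternant n (\<lambda>i. tcol u v w (n - 1) (i - 1)) ?x)"
      unfolding Suc.IH prod.distrib by (simp add: algebra_simps)
    \<comment> \<open>Multiplying every row by its variable raises the parameter
      \<open>n - 1\<close> of the columns to \<open>n\<close>.\<close>
    also have "(\<Prod>j=1..n. ?x j) * alternant n (\<lambda>i. tcol u v w (n - 1) (i - 1)) ?x = alternant n ?g ?x"
      unfolding alternant_scale_rows[where c="\<lambda>t. t"]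
      by (rule alternant_cong) (use tcol_Suc[of _ "n - 1" u v w] in auto)
    also have "(\<Prod>j=1..n. v + x k * (w + u * ?x j)) = (\<Prod>j\<in>{1..Suc n} - {k}. v + x k * (w + u * x j))"
    proof (rule prod.reindex_bij_witness[where i="?tr k" and j="?tr k"])
      fix j assume "j \<in> {1..n}"
      then show "?tr k j \<in> {1..Suc n} - {k}" using k by (auto simp: transpose_def)
    next
      fix j assume "j \<in> {1..Suc n} - {k}"
      then show "?tr k j \<in> {1..n}" using k by (auto simp: transpose_def)
    qed auto
    also have "\<dots> = q (x k)" using \<gamma>[OF k] by (simp add: q_def)
    finally show ?thesis .
  qed
  have "asym (Suc n) (rev_summand u v w (Suc n)) x = alternant (Suc n) (?g(Suc n := q)) x"
    unfolding asym_Suc alternant_Suc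
  proof (intro sum.cong refl arg_cong2[where f="(*)"])
    fix k assume k: "k \<in> {1..Suc n}"
    have "alternant n (?g(Suc n := q)) (\<lambda>i. x (?tr k i)) = alternant n ?g (\<lambda>i. x (?tr k i))"
      by (rule alternant_cong) auto
    then show "asym n (\<lambda>y. rev_summand u v w (Suc n) (y(Suc n := x k))) (\<lambda>i. x (?tr k i)) =
      (?g(Suc n := q)) (Suc n) (x k) * alternant n (?g(Suc n := q)) (\<lambda>i. x (?tr k i))"
      using step[OF k] by simp
  qed
  also have "q = (\<lambda>t. \<Sum>c\<in>{..<Suc n}. (if c = n then 1 else \<gamma> c) * tcol u v w n c t)"
    by (auto simp: q_def add.commute intro!: sum.cong)
  also have "alternant (Suc n) (?g(Suc n := \<dots>)) x =
      (\<Sum>c<Suc n. (if c = n then 1 else \<gamma> c) * alternant (Suc n) (?g(Suc n := tcol u v w n c)) x)"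
    by (rule alternant_column_sum) auto
  also have "\<dots> = alternant (Suc n) (?g(Suc n := tcol u v w n n)) x"
  proof -
    have "alternant (Suc n) (?g(Suc n := tcol u v w n c)) x = 0" if "c < n" for c
      by (rule alternant_eq_columns[of "Suc c" _ "Suc n"]) (use that in auto)
    then show ?thesis by simp
  qed
  also have "\<dots> = alternant (Suc n) (\<lambda>i. tcol u v w (Suc n - 1) (i - 1)) x"
    by (rule alternant_cong) auto
  finally show ?case .
qed

section \<open>Reversal of the variables\<close>

definition rev_perm :: "nat \<Rightarrow> nat \<Rightarrow> nat" where
  "rev_perm n i = (if i \<in> {1..n} then Suc n - i else i)"

lemma rev_perm_permutes: "rev_perm n permutes {1..n}"
  by (rule bij_imp_permutes, rule bij_betw_byWitness[where f'="rev_perm n"]) (auto simp: rev_perm_def)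

lemma prod_triangle_rev:
  "(\<Prod>i=1..n. \<Prod>j\<in>{1..<i}. f i j) = (\<Prod>i=1..n. \<Prod>j\<in>{i<..n}. f (Suc n - i) (Suc n - j) :: 'a::comm_ring_1)"
proof -
  have "(\<Prod>j\<in>{1..<i}. f i j) = (\<Prod>j\<in>{Suc n - i<..n}. f i (Suc n - j))" if "i \<in> {1..n}" for i
    by (rule prod.reindex_bij_witness[where i="\<lambda>j. Suc n - j" and j="\<lambda>j. Suc n - j"]) (use that in auto)
  then have "(\<Prod>i=1..n. \<Prod>j\<in>{1..<i}. f i j) = (\<Prod>i=1..n. \<Prod>j\<in>{Suc n - i<..n}. f i (Suc n - j))"
    by (rule prod.cong[OF refl])
  also have "\<dots> = (\<Prod>i=1..n. \<Prod>j\<in>{i<..n}. f (Suc n - i) (Suc n - j))"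
    by (rule prod.reindex_bij_witness[where i="\<lambda>j. Suc n - j" and j="\<lambda>j. Suc n - j"]) auto
  finally show ?thesis .
qed

lemma asym_A_summand:
  "asym n (A_summand u v n) x =
    of_int (sign (rev_perm n)) * alternant n (\<lambda>i. tcol u v (1 - u - v) (n - 1) (i - 1)) x"
proof -
  have "A_summand u v n y = rev_summand u v (1 - u - v) n (\<lambda>i. y (rev_perm n i))" for y
  proof -
    have "(\<Prod>i=1..n. y i ^ (i - 1)) = (\<Prod>i=1..n. y (rev_perm n i) ^ (n - i))"
      by (rule prod.reindex_bij_witness[where i="\<lambda>j. Suc n - j" and j="\<lambda>j. Suc n - j"]) (auto simp: rev_perm_def)
    moreover have "(\<Prod>i=1..n. \<Prod>j\<in>{i<..n}. v + (1 - u - v) * y i + u * y i * y j) =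
       (\<Prod>i=1..n. \<Prod>j\<in>{i<..n}. v + (1 - u - v) * y (rev_perm n (Suc n - i)) + u * y (rev_perm n (Suc n - i)) * y (rev_perm n (Suc n - j)))"
      by (intro prod.cong refl) (auto simp: rev_perm_def)
    ultimately show ?thesis
      unfolding A_summand_def rev_summand_def prod_triangle_rev by simp
  qed
  then have "asym n (A_summand u v n) x = of_int (sign (rev_perm n)) * asym n (rev_summand u v (1 - u - v) n) x"
    using asym_compose_arg[OF rev_perm_permutes, of n "rev_summand u v (1 - u - v) n" x]
    by (simp add: fun_eq_iff[of "A_summand u v n", symmetric] asym_def)
  then show ?thesis by (simp add: asym_rev_summand)
qed

subsection \<open>Schur polynomials as quotients of alternants\<close>

lemma alternant_add_column:
  assumes "i \<in> {1..n}" "j \<in> {1..n}" "i \<noteq> j"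
  shows "alternant n (g(i := \<lambda>t. g i t + c * g j t)) x = alternant n g x"
proof -
  have "alternant n (g(i := \<lambda>t. \<Sum>k\<in>{i, j}. (if k = i then 1 else c) * g k t)) x =
     (\<Sum>k\<in>{i, j}. (if k = i then 1 else c) * alternant n (g(i := g k)) x)"
    by (rule alternant_column_sum) (use assms in auto)
  moreover have "alternant n (g(i := g j)) x = 0"
    by (rule alternant_eq_columns[of i _ j]) (use assms in auto)
  ultimately show ?thesis using assms(3) by simp
qed

lemma alternant_expand:
  assumes "\<And>i. i \<in> {1..n} \<Longrightarrow> finite (K i)"
  shows "alternant n (\<lambda>i t. \<Sum>k\<in>K i. c i k * f i k t) x =
    (\<Sum>m\<in>PiE {1..n} K. (\<Prod>i=1..n. c i (m i)) * alternant n (\<lambda>i. f i (m i)) x)"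
proof -
  have *: "(\<Prod>i=1..n. \<Sum>k\<in>K i. c i k * f i k (y i)) =
    (\<Sum>m\<in>PiE {1..n} K. (\<Prod>i=1..n. c i (m i)) * (\<Prod>i=1..n. f i (m i) (y i)))" for y
    using assms by (subst prod_sum_PiE) (simp_all add: prod.distrib)
  show ?thesis
    unfolding alternant_def asym_def * sum_distrib_left
    by (subst sum.swap) (intro sum.cong refl, simp add: ac_simps)
qed

lemma power_diff_factor:
  fixes t z :: "'a::comm_ring_1"
  assumes "m \<le> l"
  shows "t ^ l - z ^ (l - m) * t ^ m = (t - z) * (\<Sum>k\<in>{m..<l}. z ^ (l - 1 - k) * t ^ k)"
  using assms
proof (induction l rule: dec_induct)
  case (step l)
  have "(\<Sum>k\<in>{m..<l}. z ^ (Suc l - 1 - k) * t ^ k) = z * (\<Sum>k\<in>{m..<l}. z ^ (l - 1 - k) * t ^ k)"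
    unfolding sum_distrib_left
    by (intro sum.cong refl) (auto simp flip: power_Suc simp: mult.assoc[symmetric] Suc_diff_Suc)
  then have "(\<Sum>k\<in>{m..<Suc l}. z ^ (Suc l - 1 - k) * t ^ k) = z * (\<Sum>k\<in>{m..<l}. z ^ (l - 1 - k) * t ^ k) + t ^ l"
    using step.hyps by simp
  then have "(t - z) * (\<Sum>k\<in>{m..<Suc l}. z ^ (Suc l - 1 - k) * t ^ k) =
     z * (t ^ l - z ^ (l - m) * t ^ m) + (t - z) * t ^ l"
    unfolding step.IH by (simp only: distrib_left mult.left_commute)
  also have "\<dots> = t ^ Suc l - z ^ (Suc l - m) * t ^ m"
    using step.hyps by (simp add: algebra_simps Suc_diff_le)
  finally show ?case ..
qed simp

text \<open>Subtracting from each column the multiple of the next that agrees with it at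
  \<open>z = x (Suc n)\<close> clears the row of \<open>z\<close> except for its last entry. The
  other columns become divisible by \<open>t - z\<close>, and the quotients run over the exponents
  from \<open>l (Suc i)\<close> to \<open>l i - 1\<close>, which is the interlacing condition of the
  branching rule.\<close>

lemma alternant_powers_Suc:
  fixes x :: "nat \<Rightarrow> 'a::comm_ring_1"
  assumes dec: "\<And>i. i \<in> {1..n} \<Longrightarrow> l (Suc i) \<le> l i"
  shows "alternant (Suc n) (\<lambda>i t. t ^ l i) x =
    x (Suc n) ^ l (Suc n) * (\<Prod>i=1..n. x i - x (Suc n)) *
    (\<Sum>m\<in>PiE {1..n} (\<lambda>i. {l (Suc i)..<l i}). (\<Prod>i=1..n. x (Suc n) ^ (l i - 1 - m i)) * alternant n (\<lambda>i t. t ^ m i) x)"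
proof -
  define z where "z = x (Suc n)"
  define g where "g i t = t ^ l i - z ^ (l i - l (Suc i)) * t ^ l (Suc i)" for i t
  \<comment> \<open>Columns are changed from left to right, so that the right neighbour is still a
    power of \<open>t\<close> when it is subtracted.\<close>
  define h where "h j i = (if i \<le> j then g i else (\<lambda>t. t ^ l i))" for j i :: nat
  have cols: "j \<le> n \<Longrightarrow> alternant (Suc n) (h j) x = alternant (Suc n) (\<lambda>i t. t ^ l i) x" for j
  proof (induction j)
    case 0
    show ?case by (rule alternant_cong) (simp add: h_def)
  next
    case (Suc j)
    have "h (Suc j) = (h j)(Suc j := \<lambda>t. h j (Suc j) t + (- (z ^ (l (Suc j) - l (Suc (Suc j))))) * h j (Suc (Suc j)) t)"
      by (auto simp: h_def g_def fun_eq_iff)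
    then have "alternant (Suc n) (h (Suc j)) x = alternant (Suc n) (h j) x"
      using alternant_add_column[of "Suc j" "Suc n" "Suc (Suc j)" "h j" "- (z ^ (l (Suc j) - l (Suc (Suc j))))" x] Suc.prems
      by simp
    then show ?case using Suc by simp
  qed
  \<comment> \<open>For \<open>k \<le> n\<close> the transposition puts \<open>z\<close> among the
    first \<open>n\<close> variables, and every one of these columns vanishes at
    \<open>z\<close>.\<close>
  have zero: "alternant n (h n) (\<lambda>i. x (transpose (Suc n) k i)) = 0" if k: "k \<in> {1..n}" for k
    unfolding alternant_def asym_def
  proof (rule sum.neutral, rule ballI)
    fix \<sigma> assume "\<sigma> \<in> {\<sigma>. \<sigma> permutes {1..n}}"
    then have \<sigma>: "\<sigma> permutes {1..n}" by simp
    then obtain i where i: "i \<in> {1..n}" "\<sigma> i = k"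
      using k permutes_image[OF \<sigma>] by (metis imageE)
    have "(\<Prod>i=1..n. h n i (x (transpose (Suc n) k (\<sigma> i)))) = 0"
      using i(1)
    proof (rule prod_zero[OF finite_atLeastAtMost, OF bexI[rotated]])
      have "l (Suc i) \<le> l i" using dec i by simp
      then show "h n i (x (transpose (Suc n) k (\<sigma> i))) = 0"
        using i by (simp add: h_def g_def z_def[symmetric] flip: power_add)
    qed
    then show "of_int (sign \<sigma>) * (\<Prod>i=1..n. h n i (x (transpose (Suc n) k (\<sigma> i)))) = 0" by simp
  qed
  have "alternant (Suc n) (\<lambda>i t. t ^ l i) x = h n (Suc n) z * alternant n (h n) x"
    using cols[OF order_refl] alternant_Suc[of n "h n" x] zero by (simp add: z_def)
  also have "alternant n (h n) x = alternant n (\<lambda>i t. (t - z) * (\<Sum>k\<in>{l (Suc i)..<l i}. z ^ (l i - 1 - k) * t ^ k)) x"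
    by (rule alternant_cong) (simp add: h_def g_def power_diff_factor dec)
  also have "\<dots> = (\<Prod>i=1..n. x i - z) * alternant n (\<lambda>i t. \<Sum>k\<in>{l (Suc i)..<l i}. z ^ (l i - 1 - k) * t ^ k) x"
    by (rule alternant_scale_rows[where c="\<lambda>t. t - z", symmetric])
  also have "alternant n (\<lambda>i t. \<Sum>k\<in>{l (Suc i)..<l i}. z ^ (l i - 1 - k) * t ^ k) x =
     (\<Sum>m\<in>PiE {1..n} (\<lambda>i. {l (Suc i)..<l i}). (\<Prod>i=1..n. z ^ (l i - 1 - m i)) * alternant n (\<lambda>i t. t ^ m i) x)"
    by (rule alternant_expand) simp
  finally show ?thesis by (simp add: h_def z_def mult.assoc)
qed

section \<open>Tableaux and the branching rule\<close>

definition partition_upto :: "nat \<Rightarrow> (nat \<Rightarrow> nat) \<Rightarrow> bool" where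
  "partition_upto n lam \<longleftrightarrow> (\<forall>i\<ge>1. lam (Suc i) \<le> lam i) \<and> (\<forall>i>n. lam i = 0)"

lemma young_cells_Sigma: "partition_upto n lam \<Longrightarrow> young_cells lam = Sigma {1..n} (\<lambda>i. {1..lam i})"
  by (auto simp: young_cells_def partition_upto_def) (metis not_le not_less_eq_eq le_0_eq)

lemma card_young_cells: "partition_upto n lam \<Longrightarrow> card (young_cells lam) = (\<Sum>i=1..n. lam i)"
  by (simp add: young_cells_Sigma)

lemma finite_young_cells: "partition_upto n lam \<Longrightarrow> finite (young_cells lam)"
  by (simp add: young_cells_Sigma)

lemma finite_ssyt:
  assumes "partition_upto n lam"
  shows "finite (ssyt lam N)"
proof (rule finite_subset)
  let ?F = "{f. \<forall>x. (x \<in> young_cells lam \<longrightarrow> f x \<in> {1..N}) \<and> (x \<notin> young_cells lam \<longrightarrow> f x = (0::nat))}"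
  show "finite (curry ` ?F)"
    by (intro finite_imageI finite_set_of_finite_funs finite_young_cells[OF assms]) simp
  show "ssyt lam N \<subseteq> curry ` ?F"
    by (rule subsetI, rule_tac x="case_prod x" in image_eqI) (auto simp: ssyt_def)
qed

lemma ssyt_row_index_le:
  assumes "partition_upto n lam" "t \<in> ssyt lam N" "(i, j) \<in> young_cells lam"
  shows "i \<le> t i j"
  using assms(3)
proof (induction i)
  case (Suc i)
  show ?case
  proof (cases "i = 0")
    case True
    then show ?thesis using assms(2) Suc.prems by (auto simp: ssyt_def)
  next
    case False
    then have "lam (Suc i) \<le> lam i" using assms(1) by (simp add: partition_upto_def)
    then have c: "(i, j) \<in> young_cells lam" using Suc.prems False by (auto simp: young_cells_def)
    then have "t i j < t (i + 1) j" using assms(2) Suc.prems by (auto simp: ssyt_def)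
    then show ?thesis using Suc.IH[OF c] by simp
  qed
qed simp

text \<open>The \<open>mu\<close> for which \<open>lam / mu\<close> is a horizontal strip: the
  shapes left after deleting the largest entry.\<close>

definition interlacing :: "nat \<Rightarrow> (nat \<Rightarrow> nat) \<Rightarrow> (nat \<Rightarrow> nat) set" where
  "interlacing n lam = {mu. (\<forall>i\<in>{1..n}. lam (Suc i) \<le> mu i \<and> mu i \<le> lam i) \<and> (\<forall>i. i \<notin> {1..n} \<longrightarrow> mu i = 0)}"

lemma finite_interlacing: "finite (interlacing n lam)"
proof (rule finite_subset)
  show "finite {f. \<forall>i. (i \<in> {1..n} \<longrightarrow> f i \<in> {0..Max (lam ` {1..n})}) \<and> (i \<notin> {1..n} \<longrightarrow> f i = (0::nat))}"
    by (rule finite_set_of_finite_funs) auto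
  show "interlacing n lam \<subseteq> {f. \<forall>i. (i \<in> {1..n} \<longrightarrow> f i \<in> {0..Max (lam ` {1..n})}) \<and> (i \<notin> {1..n} \<longrightarrow> f i = (0::nat))}"
    by (auto simp: interlacing_def) (metis (no_types, lifting) Max_ge atLeastAtMost_iff finite_atLeastAtMost finite_imageI image_eqI le_trans One_nat_def)
qed

lemma interlacing_partition:
  assumes "mu \<in> interlacing n lam"
  shows "partition_upto n mu"
  unfolding partition_upto_def
proof (intro conjI allI impI)
  fix i :: nat assume "1 \<le> i"
  then show "mu (Suc i) \<le> mu i"
  proof (cases "Suc i \<le> n")
    case True
    then have "mu (Suc i) \<le> lam (Suc i)" "lam (Suc i) \<le> mu i"
      using assms \<open>1 \<le> i\<close> by (auto simp: interlacing_def)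
    then show ?thesis by simp
  qed (use assms in \<open>auto simp: interlacing_def\<close>)
qed (use assms in \<open>auto simp: interlacing_def\<close>)

definition ssyt_shape :: "nat \<Rightarrow> (nat \<Rightarrow> nat) \<Rightarrow> (nat \<Rightarrow> nat \<Rightarrow> nat) \<Rightarrow> nat \<Rightarrow> nat" where
  "ssyt_shape n lam t i = (if i \<in> {1..n} then card {j \<in> {1..lam i}. t i j \<le> n} else 0)"

lemma young_cells_ssyt_shape:
  assumes "partition_upto (Suc n) lam" "t \<in> ssyt lam (Suc n)"
  shows "(i, j) \<in> young_cells (ssyt_shape n lam t) \<longleftrightarrow> (i, j) \<in> young_cells lam \<and> t i j \<le> n"
proof (cases "i \<in> {1..n}")
  case True
  let ?J = "{j \<in> {1..lam i}. t i j \<le> n}"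
  have "?J = {1..card ?J}"
  proof (rule initial_segment_eq)
    fix j assume j: "1 \<le> j" "Suc j \<in> ?J"
    then have "(i, j) \<in> young_cells lam" "(i, j + 1) \<in> young_cells lam"
      using True by (auto simp: young_cells_def)
    then have "t i j \<le> t i (j + 1)" using assms(2) by (simp add: ssyt_def)
    then show "j \<in> ?J" using j by auto
  qed auto
  then have "j \<in> ?J \<longleftrightarrow> j \<in> {1..card ?J}" by simp
  then show ?thesis using True by (auto simp: ssyt_shape_def young_cells_def)
next
  case False
  have "\<not> ((i, j) \<in> young_cells lam \<and> t i j \<le> n)"
  proof
    assume *: "(i, j) \<in> young_cells lam \<and> t i j \<le> n"
    then have "i \<le> n" using ssyt_row_index_le[OF assms, of i j] by simp
    then show False using False * by (auto simp: young_cells_def)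
  qed
  moreover have "(i, j) \<notin> young_cells (ssyt_shape n lam t)"
    using False by (auto simp: ssyt_shape_def young_cells_def)
  ultimately show ?thesis by simp
qed

lemma ssyt_shape_interlacing:
  assumes "partition_upto (Suc n) lam" "t \<in> ssyt lam (Suc n)"
  shows "ssyt_shape n lam t \<in> interlacing n lam"
proof -
  have "lam (Suc i) \<le> ssyt_shape n lam t i \<and> ssyt_shape n lam t i \<le> lam i" if i: "i \<in> {1..n}" for i
  proof
    have "card {j \<in> {1..lam i}. t i j \<le> n} \<le> card {1..lam i}" by (rule card_mono) auto
    then show "ssyt_shape n lam t i \<le> lam i" using i by (simp add: ssyt_shape_def)
    show "lam (Suc i) \<le> ssyt_shape n lam t i"
    proof (cases "lam (Suc i) = 0")
      case False
      have "lam (Suc i) \<le> lam i" using assms(1) i by (simp add: partition_upto_def)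
      then have c: "(i, lam (Suc i)) \<in> young_cells lam" "(i + 1, lam (Suc i)) \<in> young_cells lam"
        using False i by (auto simp: young_cells_def)
      then have "t i (lam (Suc i)) < t (i + 1) (lam (Suc i))" "t (i + 1) (lam (Suc i)) \<le> Suc n"
        using assms(2) by (auto simp: ssyt_def)
      then have "(i, lam (Suc i)) \<in> young_cells (ssyt_shape n lam t)"
        using young_cells_ssyt_shape[OF assms] c by simp
      then show ?thesis by (simp add: young_cells_def)
    qed simp
  qed
  then show ?thesis by (auto simp: interlacing_def ssyt_shape_def)
qed

definition ssyt_restrict :: "(nat \<Rightarrow> nat) \<Rightarrow> (nat \<Rightarrow> nat \<Rightarrow> nat) \<Rightarrow> nat \<Rightarrow> nat \<Rightarrow> nat" where
  "ssyt_restrict mu t i j = (if (i, j) \<in> young_cells mu then t i j else 0)"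

definition ssyt_extend :: "nat \<Rightarrow> (nat \<Rightarrow> nat) \<Rightarrow> (nat \<Rightarrow> nat) \<Rightarrow> (nat \<Rightarrow> nat \<Rightarrow> nat) \<Rightarrow> nat \<Rightarrow> nat \<Rightarrow> nat" where
  "ssyt_extend n lam mu s i j =
    (if (i, j) \<in> young_cells mu then s i j else if (i, j) \<in> young_cells lam then Suc n else 0)"

lemma interlacing_young_cells:
  assumes "mu \<in> interlacing n lam"
  shows "young_cells mu \<subseteq> young_cells lam"
proof -
  have "mu i \<le> lam i" for i
    using assms by (cases "i \<in> {1..n}") (auto simp: interlacing_def)
  then show ?thesis by (auto simp: young_cells_def intro: le_trans)
qed

lemma ssyt_restrict_in_ssyt:
  assumes "partition_upto (Suc n) lam" "t \<in> ssyt lam (Suc n)"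
  shows "ssyt_restrict (ssyt_shape n lam t) t \<in> ssyt (ssyt_shape n lam t) n"
  using assms(2) unfolding ssyt_def
  by (auto simp: ssyt_restrict_def young_cells_ssyt_shape[OF assms, unfolded One_nat_def])

lemma ssyt_extend_in_ssyt:
  assumes lam: "partition_upto (Suc n) lam" and mu: "mu \<in> interlacing n lam" and s: "s \<in> ssyt mu n"
  shows "ssyt_extend n lam mu s \<in> ssyt lam (Suc n)"
proof -
  have sub: "(i, j) \<in> young_cells mu \<Longrightarrow> (i, j) \<in> young_cells lam" for i j
    using interlacing_young_cells[OF mu] by auto
  have s1: "s i j \<in> {1..n}" if "(i, j) \<in> young_cells mu" for i j using s that by (simp add: ssyt_def)
  have row: "ssyt_extend n lam mu s i j \<le> ssyt_extend n lam mu s i (j + 1)"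
    if "(i, j) \<in> young_cells lam" "(i, j + 1) \<in> young_cells lam" for i j
  proof (cases "(i, j + 1) \<in> young_cells mu")
    case True
    then have "(i, j) \<in> young_cells mu" using that by (auto simp: young_cells_def)
    then show ?thesis using True s by (simp add: ssyt_extend_def ssyt_def)
  next
    case False
    then show ?thesis using that s1[of i j] by (auto simp: ssyt_extend_def)
  qed
  have col: "ssyt_extend n lam mu s i j < ssyt_extend n lam mu s (i + 1) j"
    if c: "(i, j) \<in> young_cells lam" "(i + 1, j) \<in> young_cells lam" for i j
  proof -
    have "i + 1 \<le> Suc n"
      using c(2) lam by (auto simp: young_cells_def partition_upto_def) (metis not_less_eq_eq not_le le_0_eq)
    \<comment> \<open>Interlacing puts the cell above any cell of row \<open>i + 1\<close> of
      \<open>lam\<close> into \<open>mu\<close>, so \<open>Suc n\<close> never occurs twice in a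
      column.\<close>
    then have "lam (Suc i) \<le> mu i" using mu c by (auto simp: interlacing_def young_cells_def)
    then have "(i, j) \<in> young_cells mu" using c by (auto simp: young_cells_def)
    moreover from this have "s i j < Suc n" using s1[of i j] by simp
    ultimately show ?thesis using s c by (auto simp: ssyt_extend_def ssyt_def)
  qed
  have "ssyt_extend n lam mu s i j \<in> {1..Suc n}" if "(i, j) \<in> young_cells lam" for i j
    using that s1[of i j] by (auto simp: ssyt_extend_def)
  moreover have "ssyt_extend n lam mu s i j = 0" if "(i, j) \<notin> young_cells lam" for i j
    using that sub by (auto simp: ssyt_extend_def)
  ultimately show ?thesis using row col by (simp add: ssyt_def)
qed

lemma ssyt_shape_extend:
  assumes lam: "partition_upto (Suc n) lam" and mu: "mu \<in> interlacing n lam" and s: "s \<in> ssyt mu n"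
  shows "ssyt_shape n lam (ssyt_extend n lam mu s) = mu"
proof
  fix i
  show "ssyt_shape n lam (ssyt_extend n lam mu s) i = mu i"
  proof (cases "i \<in> {1..n}")
    case True
    have sub: "(i, j) \<in> young_cells mu \<Longrightarrow> (i, j) \<in> young_cells lam" for j
      using interlacing_young_cells[OF mu] by auto
    have s1: "s i j \<in> {1..n}" if "(i, j) \<in> young_cells mu" for i j using s that by (simp add: ssyt_def)
    have "{j \<in> {1..lam i}. ssyt_extend n lam mu s i j \<le> n} = {1..mu i}"
    proof (intro set_eqI iffI)
      fix j assume "j \<in> {j \<in> {1..lam i}. ssyt_extend n lam mu s i j \<le> n}"
      then show "j \<in> {1..mu i}" using True
        by (auto simp: ssyt_extend_def young_cells_def split: if_splits)
    next
      fix j assume "j \<in> {1..mu i}"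
      then have c: "(i, j) \<in> young_cells mu" using True by (auto simp: young_cells_def)
      then show "j \<in> {j \<in> {1..lam i}. ssyt_extend n lam mu s i j \<le> n}"
        using s1[OF c] sub[OF c] by (auto simp: ssyt_extend_def young_cells_def)
    qed
    then show ?thesis using True by (simp add: ssyt_shape_def)
  qed (use mu in \<open>auto simp: ssyt_shape_def interlacing_def\<close>)
qed

lemma prod_ssyt_extend:
  fixes x :: "nat \<Rightarrow> 'a::comm_ring_1"
  assumes lam: "partition_upto (Suc n) lam" and mu: "mu \<in> interlacing n lam"
  shows "(\<Prod>(i, j)\<in>young_cells lam. x (ssyt_extend n lam mu s i j)) =
    x (Suc n) ^ ((\<Sum>i=1..n. lam i - mu i) + lam (Suc n)) * (\<Prod>(i, j)\<in>young_cells mu. x (s i j))"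
proof -
  have sub: "young_cells mu \<subseteq> young_cells lam" by (rule interlacing_young_cells[OF mu])
  have fin: "finite (young_cells lam)" "finite (young_cells mu)"
    using finite_young_cells lam interlacing_partition[OF mu] by blast+
  have le: "mu i \<le> lam i" if "i \<in> {1..n}" for i using mu that by (auto simp: interlacing_def)
  have "card (young_cells lam - young_cells mu) = (\<Sum>i=1..Suc n. lam i) - (\<Sum>i=1..n. mu i)"
    using card_Diff_subset[OF fin(2) sub] card_young_cells[OF lam] card_young_cells[OF interlacing_partition[OF mu]] by simp
  also have "\<dots> = (\<Sum>i=1..n. lam i - mu i) + lam (Suc n)"
    using sum_subtractf_nat[of "{1..n}" mu lam] sum_mono[of "{1..n}" mu lam] le by simp
  finally have card: "card (young_cells lam - young_cells mu) = (\<Sum>i=1..n. lam i - mu i) + lam (Suc n)" .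
  have "(\<Prod>(i, j)\<in>young_cells lam - young_cells mu. x (ssyt_extend n lam mu s i j)) =
      (\<Prod>p\<in>young_cells lam - young_cells mu. x (Suc n))"
    by (intro prod.cong refl) (auto simp: ssyt_extend_def)
  moreover have "(\<Prod>(i, j)\<in>young_cells mu. x (ssyt_extend n lam mu s i j)) = (\<Prod>(i, j)\<in>young_cells mu. x (s i j))"
    by (intro prod.cong refl) (auto simp: ssyt_extend_def)
  ultimately show ?thesis
    unfolding prod.subset_diff[OF sub fin(1)] by (simp add: card)
qed

lemma schur_branching:
  assumes lam: "partition_upto (Suc n) lam"
  shows "schur lam (Suc n) x = (\<Sum>mu\<in>interlacing n lam.
    x (Suc n) ^ ((\<Sum>i=1..n. lam i - mu i) + lam (Suc n)) * schur mu n x)"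
proof -
  have "schur lam (Suc n) x = (\<Sum>(mu, s)\<in>Sigma (interlacing n lam) (\<lambda>mu. ssyt mu n).
    x (Suc n) ^ ((\<Sum>i=1..n. lam i - mu i) + lam (Suc n)) * (\<Prod>(i, j)\<in>young_cells mu. x (s i j)))"
    unfolding schur_def
  proof (rule sum.reindex_bij_witness[where i="\<lambda>(mu, s). ssyt_extend n lam mu s"
        and j="\<lambda>t. (ssyt_shape n lam t, ssyt_restrict (ssyt_shape n lam t) t)"])
    fix t assume t: "t \<in> ssyt lam (Suc n)"
    let ?mu = "ssyt_shape n lam t" and ?s = "ssyt_restrict (ssyt_shape n lam t) t"
    have "ssyt_extend n lam ?mu ?s i j = t i j" for i j
    proof -
      have "t i j = Suc n" if "(i, j) \<in> young_cells lam" "\<not> t i j \<le> n"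
      proof -
        have "t i j \<in> {1..Suc n}" using t that(1) by (simp add: ssyt_def)
        then show ?thesis using that(2) by auto
      qed
      moreover have "t i j = 0" if "(i, j) \<notin> young_cells lam" using t that by (simp add: ssyt_def)
      ultimately show ?thesis
        by (auto simp: ssyt_extend_def ssyt_restrict_def young_cells_ssyt_shape[OF lam t])
    qed
    then have ext: "ssyt_extend n lam ?mu ?s = t" by (simp add: fun_eq_iff)
    then show "(case (?mu, ?s) of (mu, s) \<Rightarrow> ssyt_extend n lam mu s) = t" by simp
    show "(?mu, ?s) \<in> Sigma (interlacing n lam) (\<lambda>mu. ssyt mu n)"
      using ssyt_shape_interlacing[OF lam t] ssyt_restrict_in_ssyt[OF lam t] by simp
    show "(case (?mu, ?s) of (mu, s) \<Rightarrow> x (Suc n) ^ ((\<Sum>i=1..n. lam i - mu i) + lam (Suc n)) * (\<Prod>(i, j)\<in>young_cells mu. x (s i j)))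
       = (\<Prod>(i, j)\<in>young_cells lam. x (t i j))"
      using prod_ssyt_extend[OF lam ssyt_shape_interlacing[OF lam t], of x ?s] ext by simp
  next
    fix p assume "p \<in> Sigma (interlacing n lam) (\<lambda>mu. ssyt mu n)"
    then obtain mu s where p: "p = (mu, s)" and mu: "mu \<in> interlacing n lam" and s: "s \<in> ssyt mu n" by auto
    show "(case p of (mu, s) \<Rightarrow> ssyt_extend n lam mu s) \<in> ssyt lam (Suc n)"
      using ssyt_extend_in_ssyt[OF lam mu s] p by simp
    have "ssyt_restrict mu (ssyt_extend n lam mu s) = s"
      using s by (auto simp: fun_eq_iff ssyt_restrict_def ssyt_extend_def ssyt_def)
    then show "(ssyt_shape n lam (case p of (mu, s) \<Rightarrow> ssyt_extend n lam mu s),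
       ssyt_restrict (ssyt_shape n lam (case p of (mu, s) \<Rightarrow> ssyt_extend n lam mu s)) (case p of (mu, s) \<Rightarrow> ssyt_extend n lam mu s)) = p"
      using ssyt_shape_extend[OF lam mu s] p by simp
  qed
  also have "\<dots> = (\<Sum>mu\<in>interlacing n lam. \<Sum>s\<in>ssyt mu n.
    x (Suc n) ^ ((\<Sum>i=1..n. lam i - mu i) + lam (Suc n)) * (\<Prod>(i, j)\<in>young_cells mu. x (s i j)))"
    by (rule sum.Sigma[symmetric]) (auto intro: finite_interlacing finite_ssyt interlacing_partition)
  finally show ?thesis unfolding schur_def sum_distrib_left .
qed

text \<open>The bialternant formula without division. Both sides obey the same recursion in
  \<open>n\<close>, by \<open>alternant_powers_Suc\<close> and
  \<open>schur_branching\<close>.\<close>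

theorem alternant_eq_schur:
  fixes x :: "nat \<Rightarrow> 'a::comm_ring_1"
  assumes "partition_upto n lam"
  shows "alternant n (\<lambda>i t. t ^ (lam i + n - i)) x = (\<Prod>i=1..n. \<Prod>j\<in>{i<..n}. x i - x j) * schur lam n x"
  using assms
proof (induction n arbitrary: lam)
  case 0
  then have "young_cells lam = {}" by (simp add: young_cells_Sigma)
  then have "ssyt lam 0 = {\<lambda>_ _. 0}" by (auto simp: ssyt_def fun_eq_iff)
  then show ?case using \<open>young_cells lam = {}\<close> by (simp add: schur_def)
next
  case (Suc n)
  let ?z = "x (Suc n)" and ?l = "\<lambda>i. lam i + Suc n - i"
  have lam: "\<And>i. 1 \<le> i \<Longrightarrow> lam (Suc i) \<le> lam i" using Suc.prems by (simp add: partition_upto_def)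
  \<comment> \<open>The substitution \<open>m i = mu i + n - i\<close> turns the exponent intervals
    into the interlacing conditions.\<close>
  have "(\<Sum>m\<in>PiE {1..n} (\<lambda>i. {?l (Suc i)..<?l i}). (\<Prod>i=1..n. ?z ^ (?l i - 1 - m i)) * alternant n (\<lambda>i t. t ^ m i) x)
     = (\<Sum>mu\<in>interlacing n lam. ?z ^ (\<Sum>i=1..n. lam i - mu i) * alternant n (\<lambda>i t. t ^ (mu i + n - i)) x)"
  proof (rule sum.reindex_bij_witness[where i="\<lambda>mu. \<lambda>i\<in>{1..n}. mu i + n - i"
        and j="\<lambda>m i. if i \<in> {1..n} then m i - (n - i) else 0"])
    fix m assume m: "m \<in> PiE {1..n} (\<lambda>i. {?l (Suc i)..<?l i})"
    let ?mu = "\<lambda>i. if i \<in> {1..n} then m i - (n - i) else 0"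
    have mi: "lam (Suc i) + n - i \<le> m i" "m i < lam i + Suc n - i" if "i \<in> {1..n}" for i
      using PiE_mem[OF m that] by auto
    have m_eq: "?mu i + n - i = m i" if "i \<in> {1..n}" for i
      using mi[OF that] that by auto
    show "(\<lambda>i\<in>{1..n}. ?mu i + n - i) = m"
    proof
      fix i
      show "(\<lambda>i\<in>{1..n}. ?mu i + n - i) i = m i"
        using m_eq[of i] PiE_arb[OF m, of i] by (cases "i \<in> {1..n}") auto
    qed
    show "?mu \<in> interlacing n lam"
      unfolding interlacing_def
    proof (intro CollectI conjI ballI allI impI)
      fix i assume i: "i \<in> {1..n}"
      show "lam (Suc i) \<le> ?mu i" "?mu i \<le> lam i" using mi[OF i] i by auto
    qed auto
    have "?l i - 1 - m i = lam i - ?mu i" if "i \<in> {1..n}" for i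
      using mi[OF that] that by auto
    then have "(\<Prod>i=1..n. ?z ^ (?l i - 1 - m i)) = ?z ^ (\<Sum>i=1..n. lam i - ?mu i)"
      unfolding power_sum by (intro prod.cong refl) auto
    moreover have "alternant n (\<lambda>i t. t ^ (?mu i + n - i)) x = alternant n (\<lambda>i t. t ^ m i) x"
      by (rule alternant_cong) (use m_eq in simp)
    ultimately show "?z ^ (\<Sum>i=1..n. lam i - ?mu i) * alternant n (\<lambda>i t. t ^ (?mu i + n - i)) x =
       (\<Prod>i=1..n. ?z ^ (?l i - 1 - m i)) * alternant n (\<lambda>i t. t ^ m i) x" by simp
  next
    fix mu assume mu: "mu \<in> interlacing n lam"
    have bounds: "lam (Suc i) \<le> mu i" "mu i \<le> lam i" if "i \<in> {1..n}" for i
      using mu that by (auto simp: interlacing_def)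
    show "(\<lambda>i\<in>{1..n}. mu i + n - i) \<in> PiE {1..n} (\<lambda>i. {?l (Suc i)..<?l i})"
    proof (rule PiE_I)
      fix i assume i: "i \<in> {1..n}"
      show "(\<lambda>i\<in>{1..n}. mu i + n - i) i \<in> {?l (Suc i)..<?l i}" using bounds[OF i] i by auto
    qed auto
    show "(\<lambda>i. if i \<in> {1..n} then (\<lambda>i\<in>{1..n}. mu i + n - i) i - (n - i) else 0) = mu"
      using mu by (auto simp: fun_eq_iff interlacing_def)
  qed
  also have "\<dots> = (\<Sum>mu\<in>interlacing n lam. ?z ^ (\<Sum>i=1..n. lam i - mu i) *
     ((\<Prod>i=1..n. \<Prod>j\<in>{i<..n}. x i - x j) * schur mu n x))"
    by (intro sum.cong refl arg_cong2[where f="(*)"] Suc.IH interlacing_partition)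
  finally have "alternant (Suc n) (\<lambda>i t. t ^ ?l i) x = ?z ^ ?l (Suc n) * (\<Prod>i=1..n. x i - ?z) *
     (\<Sum>mu\<in>interlacing n lam. ?z ^ (\<Sum>i=1..n. lam i - mu i) * ((\<Prod>i=1..n. \<Prod>j\<in>{i<..n}. x i - x j) * schur mu n x))"
    using alternant_powers_Suc[of n ?l x] lam by (simp add: le_diff_conv2 diff_le_mono add_mono le_SucI)
  also have "\<dots> = ((\<Prod>i=1..n. x i - ?z) * (\<Prod>i=1..n. \<Prod>j\<in>{i<..n}. x i - x j)) * schur lam (Suc n) x"
    unfolding schur_branching[OF Suc.prems] sum_distrib_left
    by (intro sum.cong refl) (simp add: power_add ac_simps)
  also have "(\<Prod>i=1..n. x i - ?z) * (\<Prod>i=1..n. \<Prod>j\<in>{i<..n}. x i - x j) = (\<Prod>i=1..Suc n. \<Prod>j\<in>{i<..Suc n}. x i - x j)"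
  proof -
    have "{i<..Suc n} = insert (Suc n) {i<..n}" if "i \<in> {1..n}" for i using that by auto
    then have "(\<Prod>i=1..n. \<Prod>j\<in>{i<..Suc n}. x i - x j) = (\<Prod>i=1..n. (x i - ?z) * (\<Prod>j\<in>{i<..n}. x i - x j))"
      by (intro prod.cong refl) simp
    then show ?thesis by (simp add: prod.distrib)
  qed
  finally show ?case .
qed

text \<open>The Schur polynomial of the empty partition is 1, so the product of differences is
  itself an alternant and inherits antisymmetry from \<open>asym\<close>.\<close>

lemma vandermonde_rev_perm:
  "vandermonde n x = of_int (sign (rev_perm n)) * (\<Prod>i=1..n. \<Prod>j\<in>{i<..n}. x i - x j)"
proof -
  have zero: "partition_upto n (\<lambda>_. 0)" by (simp add: partition_upto_def)
  have "young_cells (\<lambda>_. 0) = {}" by (auto simp: young_cells_def)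
  moreover from this have "ssyt (\<lambda>_. 0) n = {\<lambda>_ _. 0}" by (auto simp: ssyt_def fun_eq_iff)
  ultimately have s: "schur (\<lambda>_. 0) n y = 1" for y :: "nat \<Rightarrow> 'a" by (simp add: schur_def)
  let ?y = "\<lambda>i. x (rev_perm n i)"
  have "vandermonde n x = (\<Prod>i=1..n. \<Prod>j\<in>{1..<i}. x i - x j)"
    unfolding vandermonde_def
    by (simp add: prod.Sigma) (rule prod.reindex_bij_witness[where i="\<lambda>(i, j). (j, i)" and j="\<lambda>(i, j). (j, i)"], auto)
  also have "\<dots> = (\<Prod>i=1..n. \<Prod>j\<in>{i<..n}. ?y i - ?y j)"
    unfolding prod_triangle_rev by (intro prod.cong refl) (auto simp: rev_perm_def)
  also have "\<dots> = of_int (sign (rev_perm n)) * (\<Prod>i=1..n. \<Prod>j\<in>{i<..n}. x i - x j)"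
    using alternant_eq_schur[OF zero, of ?y] alternant_eq_schur[OF zero, of x]
      asym_compose_var[OF rev_perm_permutes, of n "\<lambda>y. \<Prod>i=1..n. y i ^ (n - i)" x]
    by (simp add: s alternant_def)
  finally show ?thesis .
qed

subsection \<open>Totally symmetric plane partitions as shifted arrays\<close>

text \<open>The array of a totally symmetric plane partition \<open>T\<close> has entries \<open>S i p = T i p - p + 1\<close>
  where this is positive and \<open>1 \<le> i \<le> p\<close>: it records the cells \<open>(i, p, q)\<close> of \<open>T\<close> with
  \<open>i \<le> p \<le> q\<close>. In the Frobenius notation of the diagonal of \<open>T\<close>, row \<open>i\<close> of \<open>S\<close> has
  length \<open>a i + 1\<close> and first entry \<open>b i + 1\<close>.\<close>

definition shifted_arrays :: "nat \<Rightarrow> (nat \<Rightarrow> nat \<Rightarrow> nat) set" where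
  "shifted_arrays m = {S.
     (\<forall>i p. 0 < S i p \<longrightarrow> 1 \<le> i \<and> i \<le> p \<and> S i p + p \<le> Suc m) \<and>
     (\<forall>i p. 1 \<le> i \<and> Suc i \<le> p \<longrightarrow> S (Suc i) p \<le> S i p) \<and>
     (\<forall>i p. 1 \<le> i \<and> i \<le> p \<longrightarrow> S i (Suc p) \<le> S i p - 1)}"

definition row_len :: "(nat \<Rightarrow> nat \<Rightarrow> nat) \<Rightarrow> nat \<Rightarrow> nat" where
  "row_len S i = card {p. 0 < S i p}"

definition num_rows :: "(nat \<Rightarrow> nat \<Rightarrow> nat) \<Rightarrow> nat" where
  "num_rows S = card {i. 0 < S i i}"

context
  fixes m :: nat and S :: "nat \<Rightarrow> nat \<Rightarrow> nat"
  assumes S: "S \<in> shifted_arrays m"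
begin

lemma shifted_bounds: "0 < S i p \<Longrightarrow> 1 \<le> i \<and> i \<le> p \<and> S i p + p \<le> Suc m"
  and shifted_col: "1 \<le> i \<Longrightarrow> Suc i \<le> p \<Longrightarrow> S (Suc i) p \<le> S i p"
  and shifted_row: "1 \<le> i \<Longrightarrow> i \<le> p \<Longrightarrow> S i (Suc p) \<le> S i p - 1"
  using S by (auto simp: shifted_arrays_def)

lemma shifted_index_le: "0 < S i p \<Longrightarrow> p \<le> Suc m"
  using shifted_bounds[of i p] by linarith

lemma shifted_col_mono: "1 \<le> a' \<Longrightarrow> a' \<le> a \<Longrightarrow> a \<le> b \<Longrightarrow> S a b \<le> S a' b"
proof (induction a arbitrary: a' rule: less_induct)
  case (less a)
  show ?case
  proof (cases "a' = a")
    case False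
    then obtain c where c: "a = Suc c" "a' \<le> c" using less.prems by (cases a) auto
    then show ?thesis using less.IH[of c a'] shifted_col[of c b] less.prems by simp
  qed simp
qed

text \<open>Strict decrease means that entry plus column index does not grow while entries are
  positive; for the array of a plane partition this sum is its entry plus 1.\<close>

lemma shifted_row_mono: "1 \<le> a \<Longrightarrow> a \<le> b' \<Longrightarrow> b' \<le> b \<Longrightarrow> 0 < S a b \<Longrightarrow> S a b + b \<le> S a b' + b'"
proof (induction b arbitrary: b' rule: less_induct)
  case (less b)
  show ?case
  proof (cases "b' = b")
    case False
    then obtain c where c: "b = Suc c" "b' \<le> c" using less.prems by (cases b) auto
    then have "S a (Suc c) \<le> S a c - 1" using less.prems by (intro shifted_row) auto
    then have "S a c + c \<le> S a b' + b'" using less.IH[of c b'] less.prems c by simp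
    moreover have "Suc (S a (Suc c)) \<le> S a c"
      using \<open>S a (Suc c) \<le> S a c - 1\<close> less.prems(4) c by simp
    ultimately show ?thesis using c by simp
  qed simp
qed

lemma shifted_pos_iff: "0 < S i p \<longleftrightarrow> 1 \<le> i \<and> i \<le> p \<and> p < i + row_len S i"
proof -
  have fin: "finite {p. 0 < S i p}"
    by (rule finite_subset[of _ "{..Suc m}"]) (auto dest: shifted_index_le)
  show ?thesis
  proof (cases "1 \<le> i")
    case True
    have "{p. 0 < S i p} = {i..<i + card {p. 0 < S i p}}"
    proof (rule interval_eq[OF fin])
      fix p assume "i \<le> p" "Suc p \<in> {p. 0 < S i p}"
      then show "p \<in> {p. 0 < S i p}" using shifted_row[OF True, of p] by simp
    next
      fix p assume "p \<in> {p. 0 < S i p}"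
      then show "i \<le> p" using shifted_bounds[of i p] by simp
    qed
    then have "p \<in> {p. 0 < S i p} \<longleftrightarrow> p \<in> {i..<i + row_len S i}" unfolding row_len_def by simp
    then show ?thesis using True by simp
  qed (use shifted_bounds[of i p] in auto)
qed

lemma row_len_0 [simp]: "row_len S 0 = 0"
proof -
  have "{p. 0 < S 0 p} = {}" using shifted_bounds[of 0] by auto
  then show ?thesis by (simp add: row_len_def)
qed

lemma diag_pos_iff: "0 < S i i \<longleftrightarrow> 0 < row_len S i"
  using shifted_pos_iff[of i i] by (cases i) auto

text \<open>Row \<open>Suc i\<close> starts one place further right, and above its last cell lies a
  cell of row \<open>i\<close>, which is therefore longer by at least one.\<close>

lemma row_len_strict: "1 \<le> i \<Longrightarrow> 0 < row_len S (Suc i) \<Longrightarrow> row_len S (Suc i) < row_len S i"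
proof -
  assume i: "1 \<le> i" "0 < row_len S (Suc i)"
  define p where "p = i + row_len S (Suc i)"
  have "0 < S (Suc i) p" using i by (simp add: shifted_pos_iff p_def)
  then have "0 < S i p" using shifted_col[of i p] i by (simp add: p_def)
  then show ?thesis by (simp add: shifted_pos_iff p_def)
qed

lemma diag_strict: "1 \<le> i \<Longrightarrow> 0 < S (Suc i) (Suc i) \<Longrightarrow> S (Suc i) (Suc i) < S i i"
  using shifted_col[of i "Suc i"] shifted_row[of i i] by simp

text \<open>Strictly decreasing positive entries start with a value at least their number. This
  makes \<open>S i i - row_len S i\<close>, the exponent of \<open>w\<close>, a genuine
  difference.\<close>

lemma row_len_le_diag: "row_len S i \<le> S i i"
proof (cases "row_len S i = 0")
  case False
  have i: "1 \<le> i" using False row_len_0 by (cases i) auto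
  obtain d where d: "row_len S i = Suc d" using False not0_implies_Suc by blast
  have "0 < S i (i + d)" using d i by (simp add: shifted_pos_iff)
  then show ?thesis using shifted_row_mono[of i i "i + d"] i d by simp
qed simp

lemma shifted_rows: "{i. 0 < S i i} = {1..num_rows S}"
  unfolding num_rows_def
proof (rule initial_segment_eq)
  show "finite {i. 0 < S i i}"
    by (rule finite_subset[of _ "{..Suc m}"]) (auto dest: shifted_index_le)
  show "0 \<notin> {i. 0 < S i i}" using shifted_bounds[of 0 0] by auto
  fix j :: nat assume "1 \<le> j" "Suc j \<in> {i. 0 < S i i}"
  then show "j \<in> {i. 0 < S i i}" using diag_strict[of j] by simp
qed

lemma diag_pos_iff_rows: "0 < S i i \<longleftrightarrow> 1 \<le> i \<and> i \<le> num_rows S"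
proof -
  have "i \<in> {i. 0 < S i i} \<longleftrightarrow> i \<in> {1..num_rows S}" by (simp only: shifted_rows)
  then show ?thesis by simp
qed

lemma row_len_pos_iff_rows: "0 < row_len S i \<longleftrightarrow> 1 \<le> i \<and> i \<le> num_rows S"
  using diag_pos_iff diag_pos_iff_rows by simp

lemma num_rows_le: "num_rows S \<le> m"
proof (cases "num_rows S = 0")
  case False
  then have "0 < S (num_rows S) (num_rows S)" by (simp add: diag_pos_iff_rows)
  then show ?thesis using shifted_bounds[of "num_rows S" "num_rows S"] by linarith
qed simp

end

section \<open>Lowering and raising a shifted array by 1\<close>

definition lower_array :: "(nat \<Rightarrow> nat \<Rightarrow> nat) \<Rightarrow> nat \<Rightarrow> nat \<Rightarrow> nat" where
  "lower_array S i p = S i p - 1"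

definition raise_array :: "(nat \<Rightarrow> nat \<Rightarrow> nat) \<Rightarrow> (nat \<Rightarrow> nat) \<Rightarrow> nat \<Rightarrow> nat \<Rightarrow> nat" where
  "raise_array S r i p = (if 1 \<le> i \<and> i \<le> p \<and> p < i + r i then Suc (S i p) else 0)"

text \<open>A strictly decreasing row contains the entry 1 at most once, at its end, so lowering
  shortens each row by at most one cell. The last clause is the condition found in
  \<open>row_len_strict\<close>.\<close>

definition row_extensions :: "(nat \<Rightarrow> nat) \<Rightarrow> (nat \<Rightarrow> nat) set" where
  "row_extensions r' = {r. r 0 = 0 \<and> (\<forall>i. r' i \<le> r i \<and> r i \<le> Suc (r' i)) \<and>
     (\<forall>i\<ge>1. 0 < r (Suc i) \<longrightarrow> r (Suc i) < r i)}"

lemma lower_array_shifted: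
  assumes "S \<in> shifted_arrays (Suc m)"
  shows "lower_array S \<in> shifted_arrays m"
  unfolding shifted_arrays_def
proof (intro CollectI conjI allI impI; (elim conjE)?)
  fix i p assume "0 < lower_array S i p"
  then show "1 \<le> i" "i \<le> p" "lower_array S i p + p \<le> Suc m"
    using shifted_bounds[OF assms, of i p] by (auto simp: lower_array_def)
next
  fix i p :: nat assume "1 \<le> i" "Suc i \<le> p"
  then show "lower_array S (Suc i) p \<le> lower_array S i p"
    using shifted_col[OF assms, of i p] by (simp add: lower_array_def)
next
  fix i p :: nat assume "1 \<le> i" "i \<le> p"
  then show "lower_array S i (Suc p) \<le> lower_array S i p - 1"
    using shifted_row[OF assms, of i p] by (simp add: lower_array_def)
qed

lemma row_len_extension:
  assumes "S \<in> shifted_arrays (Suc m)"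
  shows "row_len S \<in> row_extensions (row_len (lower_array S))"
proof -
  note L = lower_array_shifted[OF assms]
  have "row_len (lower_array S) i \<le> row_len S i" for i
  proof (cases "row_len (lower_array S) i = 0")
    case False
    define p where "p = i + row_len (lower_array S) i - 1"
    have i: "1 \<le> i" using False row_len_0[OF L] by (cases i) auto
    then have "0 < lower_array S i p" using False by (auto simp: shifted_pos_iff[OF L] p_def)
    then have "0 < S i p" by (simp add: lower_array_def)
    then show ?thesis using False by (auto simp: shifted_pos_iff[OF assms] p_def)
  qed simp
  moreover have "row_len S i \<le> Suc (row_len (lower_array S) i)" for i
  proof (cases "row_len S i \<le> 1")
    case False
    obtain d where d: "row_len S i = Suc (Suc d)"
      using False by (metis One_nat_def Suc_le_mono le0 not0_implies_Suc)
    have i: "1 \<le> i" using False row_len_0[OF assms] by (cases i) auto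
    have "0 < S i (Suc (i + d))" using d i by (simp add: shifted_pos_iff[OF assms])
    then have "0 < lower_array S i (i + d)"
      using shifted_row[OF assms i, of "i + d"] by (simp add: lower_array_def)
    then show ?thesis using d by (simp add: shifted_pos_iff[OF L])
  qed simp
  ultimately show ?thesis
    using row_len_strict[OF assms] row_len_0[OF assms] by (simp add: row_extensions_def)
qed

lemma raise_lower_array:
  assumes "S \<in> shifted_arrays (Suc m)"
  shows "raise_array (lower_array S) (row_len S) = S"
proof (intro ext)
  fix i p
  show "raise_array (lower_array S) (row_len S) i p = S i p"
    using shifted_pos_iff[OF assms, of i p] by (auto simp: raise_array_def lower_array_def)
qed

context
  fixes m :: nat and S :: "nat \<Rightarrow> nat \<Rightarrow> nat" and r :: "nat \<Rightarrow> nat"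
  assumes S: "S \<in> shifted_arrays m" and r: "r \<in> row_extensions (row_len S)"
begin

lemma extension_bounds: "row_len S i \<le> r i" "r i \<le> Suc (row_len S i)"
  and extension_0: "r 0 = 0"
  and extension_strict: "1 \<le> i \<Longrightarrow> 0 < r (Suc i) \<Longrightarrow> r (Suc i) < r i"
  using r by (auto simp: row_extensions_def)

text \<open>Below the old rows only rows of length 1 can arise, and two of them would violate
  strictness; a raise creates at most one row.\<close>

lemma extension_row_bound:
  assumes "0 < r i"
  shows "1 \<le> i" "i \<le> Suc (num_rows S)"
proof -
  show i: "1 \<le> i" using assms extension_0 by (cases i) auto
  show "i \<le> Suc (num_rows S)"
  proof (rule ccontr)
    assume *: "\<not> i \<le> Suc (num_rows S)"
    then obtain j where j: "i = Suc j" "num_rows S < j" by (cases i) auto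
    then have "r i < r j" using extension_strict[of j] assms by simp
    moreover have "row_len S j = 0" using row_len_pos_iff_rows[OF S, of j] j by simp
    ultimately show False using assms extension_bounds(2)[of j] by simp
  qed
qed

lemma raise_array_shifted: "raise_array S r \<in> shifted_arrays (Suc m)"
  unfolding shifted_arrays_def
proof (intro CollectI conjI allI impI; (elim conjE)?)
  fix i p assume pos: "0 < raise_array S r i p"
  then have ip: "1 \<le> i" "i \<le> p" "p < i + r i" by (auto simp: raise_array_def split: if_splits)
  then show "1 \<le> i" "i \<le> p" by auto
  \<comment> \<open>A cell that was empty before is bounded through its left neighbour or, on the
    diagonal, through the number of rows.\<close>
  have "S i p + p \<le> Suc m"
  proof (cases "0 < S i p")
    case False
    have "p \<le> Suc m"
    proof (cases "p = i")
      case True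
      then show ?thesis using extension_row_bound(2)[of i] num_rows_le[OF S] ip by simp
    next
      case False
      then have "0 < S i (p - 1)"
        using ip extension_bounds(2)[of i] by (auto simp: shifted_pos_iff[OF S])
      then show ?thesis using shifted_bounds[OF S, of i "p - 1"] by linarith
    qed
    then show ?thesis using False by simp
  qed (use shifted_bounds[OF S, of i p] in simp)
  then show "raise_array S r i p + p \<le> Suc (Suc m)" using ip by (simp add: raise_array_def)
next
  fix i p :: nat assume ip: "1 \<le> i" "Suc i \<le> p"
  then show "raise_array S r (Suc i) p \<le> raise_array S r i p"
    using shifted_col[OF S, of i p] extension_strict[of i] by (auto simp: raise_array_def)
next
  fix i p :: nat assume ip: "1 \<le> i" "i \<le> p"
  show "raise_array S r i (Suc p) \<le> raise_array S r i p - 1"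
  proof (cases "Suc p < i + r i")
    case True
    then have "0 < S i p" using ip extension_bounds(2)[of i] by (simp add: shifted_pos_iff[OF S])
    then show ?thesis using shifted_row[OF S ip] True ip by (simp add: raise_array_def)
  qed (use ip in \<open>simp add: raise_array_def\<close>)
qed

lemma lower_raise_array: "lower_array (raise_array S r) = S"
proof (intro ext)
  fix i p
  show "lower_array (raise_array S r) i p = S i p"
    using shifted_pos_iff[OF S, of i p] extension_bounds(1)[of i]
    by (auto simp: raise_array_def lower_array_def)
qed

lemma row_len_raise_array: "row_len (raise_array S r) = r"
proof
  fix i
  show "row_len (raise_array S r) i = r i"
  proof (cases "1 \<le> i")
    case True
    then have "{p. 0 < raise_array S r i p} = {i..<i + r i}" by (auto simp: raise_array_def)
    then show ?thesis by (simp add: row_len_def)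
  next
    case False
    then have "i = 0" by simp
    then show ?thesis using extension_0 by (simp add: row_len_def raise_array_def)
  qed
qed

end

lemma finite_shifted_arrays: "finite (shifted_arrays m)"
proof (rule finite_subset)
  let ?A = "{..Suc m} \<times> {..Suc m}"
  let ?F = "{f. \<forall>x. (x \<in> ?A \<longrightarrow> f x \<in> {..Suc m}) \<and> (x \<notin> ?A \<longrightarrow> f x = (0::nat))}"
  show "finite (curry ` ?F)"
    by (intro finite_imageI finite_set_of_finite_funs) simp_all
  show "shifted_arrays m \<subseteq> curry ` ?F"
  proof
    fix S assume S: "S \<in> shifted_arrays m"
    have "S i p \<le> Suc m" for i p using shifted_bounds[OF S, of i p] by (cases "S i p = 0") auto
    moreover have "S i p = 0" if "\<not> (i \<le> Suc m \<and> p \<le> Suc m)" for i p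
      using shifted_bounds[OF S, of i p] that by (cases "S i p = 0") auto
    ultimately have "case_prod S \<in> ?F" by auto
    then show "S \<in> curry ` ?F" by (rule rev_image_eqI) simp
  qed
qed

lemma finite_row_extensions:
  assumes "S \<in> shifted_arrays m"
  shows "finite (row_extensions (row_len S))"
proof (rule finite_subset)
  show "row_extensions (row_len S) \<subseteq> row_len ` shifted_arrays (Suc m)"
    using row_len_raise_array[OF assms] raise_array_shifted[OF assms] by (metis imageI subsetI)
qed (simp add: finite_shifted_arrays)

text \<open>An array amounts to its lowered array together with its own row lengths, which locate
  the entries 1.\<close>

lemma sum_shifted_arrays_Suc:
  "(\<Sum>S\<in>shifted_arrays (Suc m). \<Phi> S) =
    (\<Sum>S\<in>shifted_arrays m. \<Sum>r\<in>row_extensions (row_len S). \<Phi> (raise_array S r))"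
proof -
  have "(\<Sum>S\<in>shifted_arrays (Suc m). \<Phi> S) =
    (\<Sum>(S, r)\<in>Sigma (shifted_arrays m) (\<lambda>S. row_extensions (row_len S)). \<Phi> (raise_array S r))"
    by (rule sum.reindex_bij_witness[where i="\<lambda>(S, r). raise_array S r" and j="\<lambda>S. (lower_array S, row_len S)"])
       (auto simp: raise_lower_array lower_array_shifted row_len_extension raise_array_shifted
          lower_raise_array row_len_raise_array)
  also have "\<dots> = (\<Sum>S\<in>shifted_arrays m. \<Sum>r\<in>row_extensions (row_len S). \<Phi> (raise_array S r))"
    by (rule sum.Sigma[symmetric]) (auto intro: finite_shifted_arrays finite_row_extensions)
  finally show ?thesis .
qed

lemma shifted_arrays_0: "shifted_arrays 0 = {\<lambda>_ _. 0}"
proof (intro subset_antisym subsetI)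
  fix S assume S: "S \<in> shifted_arrays 0"
  have "S i p = 0" for i p using shifted_bounds[OF S, of i p] by (cases "S i p = 0") auto
  then show "S \<in> {\<lambda>_ _. 0}" by (simp add: fun_eq_iff)
qed (simp add: shifted_arrays_def)

section \<open>Totally symmetric plane partitions as sets of sorted triples\<close>

definition tspp_array :: "(nat \<Rightarrow> nat \<Rightarrow> nat) \<Rightarrow> nat \<Rightarrow> nat \<Rightarrow> nat" where
  "tspp_array T i p = (if 1 \<le> i \<and> i \<le> p then Suc (T i p) - p else 0)"

definition min3 :: "nat \<Rightarrow> nat \<Rightarrow> nat \<Rightarrow> nat" where
  "min3 i j k = min i (min j k)"

definition med3 :: "nat \<Rightarrow> nat \<Rightarrow> nat \<Rightarrow> nat" where
  "med3 i j k = max (min i j) (min (max i j) k)"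

definition max3 :: "nat \<Rightarrow> nat \<Rightarrow> nat \<Rightarrow> nat" where
  "max3 i j k = max i (max j k)"

lemmas sort3_defs = min3_def med3_def max3_def

lemma sort3_swap12: "min3 j i k = min3 i j k" "med3 j i k = med3 i j k" "max3 j i k = max3 i j k"
  by (auto simp: sort3_defs min_def max_def)

lemma sort3_swap23: "min3 i k j = min3 i j k" "med3 i k j = med3 i j k" "max3 i k j = max3 i j k"
  by (auto simp: sort3_defs min_def max_def)

lemma sort3_mono:
  assumes "i' \<le> i" "j' \<le> j" "k' \<le> k"
  shows "min3 i' j' k' \<le> min3 i j k" "med3 i' j' k' \<le> med3 i j k" "max3 i' j' k' \<le> max3 i j k"
  unfolding sort3_defs by (intro min.mono max.mono assms)+

lemma sort3_sorted: "min3 i j k \<le> med3 i j k" "med3 i j k \<le> max3 i j k"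
  by (auto simp: sort3_defs min_def max_def)

text \<open>For sorted coordinates a, b, c this is c \<le> T a b, written through
  \<open>S a b = T a b - b + 1\<close>; the strict inequality also excludes the places where
  \<open>S\<close> is 0. Testing only the sorted triple builds in total symmetry.\<close>

definition array_cell :: "(nat \<Rightarrow> nat \<Rightarrow> nat) \<Rightarrow> nat \<Rightarrow> nat \<Rightarrow> nat \<Rightarrow> bool" where
  "array_cell S i j k \<longleftrightarrow> 1 \<le> min3 i j k \<and> max3 i j k < med3 i j k + S (min3 i j k) (med3 i j k)"

definition array_tspp :: "(nat \<Rightarrow> nat \<Rightarrow> nat) \<Rightarrow> nat \<Rightarrow> nat \<Rightarrow> nat" where
  "array_tspp S i j = card {k. array_cell S i j k}"

text \<open>Sorting is monotone in every coordinate, so sorted triples suffice: decreasing the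
  minimum uses the columns of \<open>S\<close>, decreasing the median its rows.\<close>

lemma array_cell_mono:
  assumes S: "S \<in> shifted_arrays m" and cell: "array_cell S i j k"
    and le: "i' \<le> i" "j' \<le> j" "k' \<le> k" and pos: "1 \<le> i'" "1 \<le> j'" "1 \<le> k'"
  shows "array_cell S i' j' k'"
proof -
  let ?a = "min3 i j k" and ?b = "med3 i j k" and ?c = "max3 i j k"
  let ?a' = "min3 i' j' k'" and ?b' = "med3 i' j' k'" and ?c' = "max3 i' j' k'"
  have a': "1 \<le> ?a'" using pos by (simp add: min3_def)
  have c: "?c < ?b + S ?a ?b" using cell by (simp add: array_cell_def)
  have 1: "S ?a ?b \<le> S ?a' ?b"
    using shifted_col_mono[OF S a'] sort3_mono[OF le] sort3_sorted by simp
  have "0 < S ?a ?b" using c sort3_sorted(2)[of i j k] by simp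
  then have "S ?a' ?b + ?b \<le> S ?a' ?b' + ?b'"
    using 1 shifted_row_mono[OF S a', of ?b' ?b] sort3_mono[OF le] sort3_sorted(1) by simp
  then have "?c' < ?b' + S ?a' ?b'" using c 1 sort3_mono(3)[OF le] by linarith
  then show ?thesis using a' by (simp add: array_cell_def)
qed

lemma array_cell_bounds:
  assumes S: "S \<in> shifted_arrays m" and cell: "array_cell S i j k"
  shows "i \<in> {1..m}" "j \<in> {1..m}" "k \<in> {1..m}"
proof -
  have "0 < S (min3 i j k) (med3 i j k)"
    using cell sort3_sorted(2)[of i j k] by (simp add: array_cell_def)
  then have "1 \<le> min3 i j k" "max3 i j k \<le> m"
    using shifted_bounds[OF S, of "min3 i j k" "med3 i j k"] cell by (auto simp: array_cell_def)
  then show "i \<in> {1..m}" "j \<in> {1..m}" "k \<in> {1..m}" by (auto simp: min3_def max3_def)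
qed

lemma array_cell_iff:
  assumes S: "S \<in> shifted_arrays m"
  shows "array_cell S i j k \<longleftrightarrow> 1 \<le> k \<and> k \<le> array_tspp S i j"
proof -
  have "{k. array_cell S i j k} = {1..card {k. array_cell S i j k}}"
  proof (rule initial_segment_eq)
    show "finite {k. array_cell S i j k}"
      by (rule finite_subset[of _ "{1..m}"]) (use array_cell_bounds(3)[OF S] in auto)
    show "0 \<notin> {k. array_cell S i j k}" by (simp add: array_cell_def min3_def)
    fix k assume k: "1 \<le> k" "Suc k \<in> {k. array_cell S i j k}"
    then have "array_cell S i j (Suc k)" by simp
    then show "k \<in> {k. array_cell S i j k}"
      using array_cell_mono[OF S, of i j "Suc k" i j k] array_cell_bounds(1,2)[OF S, of i j "Suc k"] k by simp
  qed
  then have "k \<in> {k. array_cell S i j k} \<longleftrightarrow> k \<in> {1..array_tspp S i j}" unfolding array_tspp_def by simp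
  then show ?thesis by simp
qed

lemma pp_set_array_tspp:
  assumes S: "S \<in> shifted_arrays m"
  shows "(i, j, k) \<in> pp_set m (array_tspp S) \<longleftrightarrow> array_cell S i j k"
  using array_cell_iff[OF S, of i j k] array_cell_bounds[OF S, of i j k] by (auto simp: pp_set_def)

lemma array_tspp_in_TSPP:
  assumes S: "S \<in> shifted_arrays m"
  shows "array_tspp S \<in> TSPP m"
proof -
  let ?T = "array_tspp S"
  have fin: "finite {k. array_cell S i j k}" for i j
    by (rule finite_subset[of _ "{1..m}"]) (use array_cell_bounds(3)[OF S] in auto)
  have "?T i j \<le> m" for i j
    using card_mono[of "{1..m}" "{k. array_cell S i j k}"] array_cell_bounds(3)[OF S]
    by (auto simp: array_tspp_def subset_iff)
  moreover have "?T i j = 0" if "\<not> (i \<in> {1..m} \<and> j \<in> {1..m})" for i j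
  proof -
    have "{k. array_cell S i j k} = {}" using array_cell_bounds(1,2)[OF S] that by blast
    then show ?thesis by (simp add: array_tspp_def)
  qed
  moreover have "?T i (j + 1) \<le> ?T i j" if "i \<in> {1..m}" "j \<in> {1..m}" for i j
    unfolding array_tspp_def
    by (rule card_mono[OF fin])
       (use that array_cell_mono[OF S, of i "j + 1" _ i j] array_cell_bounds(3)[OF S, of i "j + 1"] in auto)
  moreover have "?T (i + 1) j \<le> ?T i j" if "i \<in> {1..m}" "j \<in> {1..m}" for i j
    unfolding array_tspp_def
    by (rule card_mono[OF fin])
       (use that array_cell_mono[OF S, of "i + 1" j _ i j] array_cell_bounds(3)[OF S, of "i + 1" j] in auto)
  moreover have "array_cell S j i k = array_cell S i j k" "array_cell S i k j = array_cell S i j k" for i j k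
    by (simp_all only: array_cell_def sort3_swap12 sort3_swap23)
  ultimately show ?thesis
    unfolding TSPP_def by (simp add: pp_set_array_tspp[OF S])
qed

lemma tspp_array_array_tspp:
  assumes S: "S \<in> shifted_arrays m"
  shows "tspp_array (array_tspp S) = S"
proof (intro ext)
  fix i p
  show "tspp_array (array_tspp S) i p = S i p"
  proof (cases "1 \<le> i \<and> i \<le> p")
    case True
    have cell: "array_cell S i p k \<longleftrightarrow> k < p + S i p" if "p \<le> k" for k
      using True that by (auto simp: array_cell_def sort3_defs min_def max_def)
    show ?thesis
    proof (cases "S i p = 0")
      case S0: True
      then have "\<not> p \<le> array_tspp S i p" using cell[of p] array_cell_iff[OF S, of i p p] True by simp
      then show ?thesis using True S0 by (simp add: tspp_array_def)
    next
      case False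
      then have "p + S i p - 1 \<le> array_tspp S i p" "\<not> p + S i p \<le> array_tspp S i p"
        using cell[of "p + S i p - 1"] cell[of "p + S i p"] array_cell_iff[OF S, of i p] True by auto
      then show ?thesis using True False by (simp add: tspp_array_def)
    qed
  next
    case False
    then show ?thesis using shifted_bounds[OF S, of i p] by (auto simp: tspp_array_def)
  qed
qed

lemma tspp_array_shifted:
  assumes T: "T \<in> TSPP m"
  shows "tspp_array T \<in> shifted_arrays m"
  unfolding shifted_arrays_def
proof (intro CollectI conjI allI impI; (elim conjE)?)
  fix i p assume "0 < tspp_array T i p"
  moreover have "T i p \<le> m" using T by (simp add: TSPP_def)
  ultimately show "1 \<le> i" "i \<le> p" "tspp_array T i p + p \<le> Suc m"
    by (auto simp: tspp_array_def split: if_splits)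
next
  fix i p :: nat assume ip: "1 \<le> i" "Suc i \<le> p"
  have "T (Suc i) p \<le> T i p"
  proof (cases "Suc i \<in> {1..m} \<and> p \<in> {1..m}")
    case True
    then have "i \<in> {1..m} \<and> p \<in> {1..m} \<and> i + 1 \<le> m" using ip by auto
    then have "T (i + 1) p \<le> T i p" using T unfolding TSPP_def by blast
    then show ?thesis by simp
  next
    case False
    then have "T (Suc i) p = 0" using T unfolding TSPP_def by blast
    then show ?thesis by simp
  qed
  then show "tspp_array T (Suc i) p \<le> tspp_array T i p" using ip by (simp add: tspp_array_def)
next
  fix i p :: nat assume ip: "1 \<le> i" "i \<le> p"
  have "T i (Suc p) \<le> T i p"
  proof (cases "i \<in> {1..m} \<and> Suc p \<in> {1..m}")
    case True
    then have "i \<in> {1..m} \<and> p \<in> {1..m} \<and> p + 1 \<le> m" using ip by auto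
    then have "T i (p + 1) \<le> T i p" using T unfolding TSPP_def by blast
    then show ?thesis by simp
  next
    case False
    then have "T i (Suc p) = 0" using T unfolding TSPP_def by blast
    then show ?thesis by simp
  qed
  then show "tspp_array T i (Suc p) \<le> tspp_array T i p - 1" using ip by (simp add: tspp_array_def)
qed

lemma TSPP_cell_iff:
  assumes T: "T \<in> TSPP m"
  shows "(i, j, k) \<in> pp_set m T \<longleftrightarrow> array_cell (tspp_array T) i j k"
proof -
  have sym: "(i, j, k) \<in> pp_set m T \<Longrightarrow> (j, i, k) \<in> pp_set m T \<and> (i, k, j) \<in> pp_set m T \<and>
     (k, j, i) \<in> pp_set m T \<and> (j, k, i) \<in> pp_set m T \<and> (k, i, j) \<in> pp_set m T" for i j k
    using T unfolding TSPP_def by blast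
  let ?a = "min3 i j k" and ?b = "med3 i j k" and ?c = "max3 i j k"
  have "(?a, ?b, ?c) \<in> {(i, j, k), (j, i, k), (i, k, j), (k, j, i), (j, k, i), (k, i, j)}"
    by (auto simp: sort3_defs min_def max_def)
  moreover have "(j, i, k) \<in> pp_set m T \<longleftrightarrow> (i, j, k) \<in> pp_set m T"
    "(i, k, j) \<in> pp_set m T \<longleftrightarrow> (i, j, k) \<in> pp_set m T"
    "(k, j, i) \<in> pp_set m T \<longleftrightarrow> (i, j, k) \<in> pp_set m T"
    "(j, k, i) \<in> pp_set m T \<longleftrightarrow> (i, j, k) \<in> pp_set m T"
    "(k, i, j) \<in> pp_set m T \<longleftrightarrow> (i, j, k) \<in> pp_set m T"
    by (rule iffI; drule sym; elim conjE; assumption)+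
  ultimately have "(i, j, k) \<in> pp_set m T \<longleftrightarrow> (?a, ?b, ?c) \<in> pp_set m T"
    by (elim insertE emptyE) metis+
  also have "\<dots> \<longleftrightarrow> 1 \<le> ?a \<and> ?c \<le> T ?a ?b"
  proof -
    have "?a \<in> {1..m} \<and> ?b \<in> {1..m}" if "1 \<le> ?a" "?c \<le> T ?a ?b"
    proof (rule ccontr)
      assume "\<not> (?a \<in> {1..m} \<and> ?b \<in> {1..m})"
      then have "T ?a ?b = 0" using T unfolding TSPP_def by blast
      then show False using that sort3_sorted[of i j k] by simp
    qed
    then show ?thesis using sort3_sorted[of i j k] by (auto simp: pp_set_def)
  qed
  also have "\<dots> \<longleftrightarrow> array_cell (tspp_array T) i j k"
    using sort3_sorted[of i j k] by (auto simp: array_cell_def tspp_array_def)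
  finally show ?thesis .
qed

lemma array_tspp_tspp_array:
  assumes T: "T \<in> TSPP m"
  shows "array_tspp (tspp_array T) = T"
proof (intro ext)
  fix i j
  have "{k. array_cell (tspp_array T) i j k} = {k. (i, j, k) \<in> pp_set m T}"
    by (simp add: TSPP_cell_iff[OF T])
  moreover have "card {k. (i, j, k) \<in> pp_set m T} = T i j"
  proof (cases "i \<in> {1..m} \<and> j \<in> {1..m}")
    case True
    then have "{k. (i, j, k) \<in> pp_set m T} = {1..T i j}" by (auto simp: pp_set_def)
    then show ?thesis by simp
  next
    case False
    then have "T i j = 0" using T unfolding TSPP_def by blast
    moreover have "{k. (i, j, k) \<in> pp_set m T} = {}" using False by (auto simp: pp_set_def)
    ultimately show ?thesis by simp
  qed
  ultimately show "array_tspp (tspp_array T) i j = T i j" by (simp add: array_tspp_def)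
qed

lemma sum_TSPP: "(\<Sum>T\<in>TSPP m. \<Phi> (tspp_array T)) = (\<Sum>S\<in>shifted_arrays m. \<Phi> S)"
  by (rule sum.reindex_bij_witness[where i=array_tspp and j=tspp_array])
     (simp_all add: array_tspp_tspp_array tspp_array_shifted tspp_array_array_tspp array_tspp_in_TSPP)

subsection \<open>Expansion of the determinant\<close>

text \<open>Columns form a list here, since single columns are moved past blocks of others.\<close>

definition list_alt :: "('a \<Rightarrow> 'a) list \<Rightarrow> (nat \<Rightarrow> 'a::comm_ring_1) \<Rightarrow> 'a" where
  "list_alt L x = alternant (length L) (\<lambda>i. L ! (i - 1)) x"

lemma list_alt_sum:
  assumes "finite K"
  shows "list_alt (P @ (\<lambda>t. \<Sum>k\<in>K. c k * f k t) # Q) x = (\<Sum>k\<in>K. c k * list_alt (P @ f k # Q) x)"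
proof -
  let ?n = "Suc (length P + length Q)"
  \<comment> \<open>\<open>undefined\<close> only reserves the position that is overwritten
    next.\<close>
  let ?g = "\<lambda>i. (P @ undefined # Q) ! (i - 1)"
  have *: "list_alt (P @ h # Q) x = alternant ?n (?g(Suc (length P) := h)) x" for h
    unfolding list_alt_def length_append list.size add_Suc_right add_0_right
    by (rule alternant_cong) (auto simp: nth_append nth_Cons' Suc_diff_Suc)
  show ?thesis unfolding * by (rule alternant_column_sum[OF assms]) simp
qed

lemma list_alt_add:
  "list_alt (P @ (\<lambda>t. f t + c * g t) # Q) x = list_alt (P @ f # Q) x + c * list_alt (P @ g # Q) x"
  using list_alt_sum[of "{False, True}" P "\<lambda>b. if b then c else 1" "\<lambda>b. if b then g else f" Q x] by simp

lemma list_alt_swap: "list_alt (P @ a # b # Q) x = - list_alt (P @ b # a # Q) x"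
proof -
  let ?n = "Suc (Suc (length P + length Q))" and ?j = "Suc (length P)"
  have "alternant ?n (\<lambda>i. (P @ b # a # Q) ! (transpose ?j (Suc ?j) i - 1)) x =
     of_int (sign (transpose ?j (Suc ?j))) * alternant ?n (\<lambda>i. (P @ b # a # Q) ! (i - 1)) x"
    by (rule alternant_permute_columns[of "transpose ?j (Suc ?j)" ?n "\<lambda>i. (P @ b # a # Q) ! (i - 1)"])
       (auto intro!: permutes_swap_id)
  moreover have "alternant ?n (\<lambda>i. (P @ b # a # Q) ! (transpose ?j (Suc ?j) i - 1)) x =
     alternant ?n (\<lambda>i. (P @ a # b # Q) ! (i - 1)) x"
    by (rule alternant_cong) (auto simp: transpose_def nth_append nth_Cons' Suc_diff_Suc)
  ultimately show ?thesis by (simp add: list_alt_def sign_swap_id)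
qed

lemma list_alt_move: "list_alt (P @ Z @ f # Q) x = (- 1) ^ length Z * list_alt (P @ f # Z @ Q) x"
proof (induction Z arbitrary: P)
  case (Cons z Z)
  show ?case using Cons[of "P @ [z]"] list_alt_swap[of P z f "Z @ Q" x] by simp
qed simp

lemma list_alt_eq_columns:
  assumes "i < length L" "j < length L" "i \<noteq> j" "L ! i = L ! j"
  shows "list_alt L x = 0"
  unfolding list_alt_def by (rule alternant_eq_columns[of "Suc i" _ "Suc j"]) (use assms in auto)

text \<open>The default is 0, the length of an absent row, so that row length functions are
  literally choices.\<close>

definition choices :: "nat set \<Rightarrow> (nat \<Rightarrow> nat set) \<Rightarrow> (nat \<Rightarrow> nat) set" where
  "choices A E = {r. (\<forall>k\<in>A. r k \<in> E k) \<and> (\<forall>k. k \<notin> A \<longrightarrow> r k = 0)}"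

lemma finite_choices: "finite A \<Longrightarrow> (\<And>k. k \<in> A \<Longrightarrow> finite (E k)) \<Longrightarrow> finite (choices A E)"
proof -
  assume "finite A" "\<And>k. k \<in> A \<Longrightarrow> finite (E k)"
  then have "finite {f. \<forall>x. (x \<in> A \<longrightarrow> f x \<in> \<Union> (E ` A)) \<and> (x \<notin> A \<longrightarrow> f x = 0)}"
    by (intro finite_set_of_finite_funs) auto
  then show ?thesis by (rule rev_finite_subset) (auto simp: choices_def)
qed

lemma sum_choices_insert:
  assumes "finite A" "\<And>k. k \<in> insert a A \<Longrightarrow> finite (E k)" "a \<notin> A"
  shows "(\<Sum>r\<in>choices (insert a A) E. \<Phi> r) = (\<Sum>e\<in>E a. \<Sum>r\<in>choices A E. \<Phi> (r(a := e)))"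
proof -
  have "(\<Sum>r\<in>choices (insert a A) E. \<Phi> r) = (\<Sum>(e, r)\<in>E a \<times> choices A E. \<Phi> (r(a := e)))"
    by (rule sum.reindex_bij_witness[where i="\<lambda>(e, r). r(a := e)" and j="\<lambda>r. (r a, r(a := 0))"])
       (use assms(3) in \<open>auto simp: choices_def fun_eq_iff\<close>)
  then show ?thesis by (simp add: sum.cartesian_product)
qed

lemma list_alt_expand:
  assumes "distinct ks" "\<And>k. k \<in> set ks \<Longrightarrow> finite (E k)"
  shows "list_alt (P @ map (\<lambda>k t. \<Sum>e\<in>E k. c k e * G k e t) ks @ Q) x =
    (\<Sum>r\<in>choices (set ks) E. (\<Prod>k\<in>set ks. c k (r k)) * list_alt (P @ map (\<lambda>k. G k (r k)) ks @ Q) x)"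
  using assms
proof (induction ks arbitrary: P)
  case Nil
  have "choices {} E = {\<lambda>_. 0}" by (auto simp: choices_def)
  then show ?case by simp
next
  case (Cons a ks)
  let ?M = "map (\<lambda>k t. \<Sum>e\<in>E k. c k e * G k e t) ks"
  have "list_alt (P @ map (\<lambda>k t. \<Sum>e\<in>E k. c k e * G k e t) (a # ks) @ Q) x =
    (\<Sum>e\<in>E a. c a e * list_alt ((P @ [G a e]) @ ?M @ Q) x)"
    using list_alt_sum[of "E a" P "c a" "G a" "?M @ Q" x] Cons.prems by simp
  also have "\<dots> = (\<Sum>e\<in>E a. c a e * (\<Sum>r\<in>choices (set ks) E. (\<Prod>k\<in>set ks. c k (r k)) *
       list_alt ((P @ [G a e]) @ map (\<lambda>k. G k (r k)) ks @ Q) x))"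
    by (intro sum.cong refl arg_cong2[where f="(*)"] Cons.IH) (use Cons.prems in auto)
  also have "\<dots> = (\<Sum>e\<in>E a. \<Sum>r\<in>choices (set ks) E. (\<Prod>k\<in>insert a (set ks). c k ((r(a := e)) k)) *
       list_alt (P @ map (\<lambda>k. G k ((r(a := e)) k)) (a # ks) @ Q) x)"
  proof -
    have "(\<Prod>k\<in>insert a (set ks). c k ((r(a := e)) k)) = c a e * (\<Prod>k\<in>set ks. c k (r k))" for r e
    proof -
      have "(\<Prod>k\<in>set ks. c k ((r(a := e)) k)) = (\<Prod>k\<in>set ks. c k (r k))"
        using Cons.prems by (intro prod.cong) auto
      then show ?thesis using Cons.prems by simp
    qed
    moreover have "map (\<lambda>k. G k ((r(a := e)) k)) (a # ks) = G a e # map (\<lambda>k. G k (r k)) ks" for r e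
      using Cons.prems by auto
    ultimately show ?thesis by (simp only: sum_distrib_left mult.assoc append_assoc append.simps)
  qed
  also have "\<dots> = (\<Sum>r\<in>choices (set (a # ks)) E. (\<Prod>k\<in>set (a # ks). c k (r k)) *
       list_alt (P @ map (\<lambda>k. G k (r k)) (a # ks) @ Q) x)"
    unfolding list.set by (rule sum_choices_insert[symmetric]) (use Cons.prems in auto)
  finally show ?case .
qed

section \<open>Pascal's recursion on columns and on arrays\<close>

text \<open>Unfolds to the sum over k of
  \<open>u * (c choose k) * w ^ (c - k) * u ^ k * f k t\<close>. Since \<open>f\<close> is
  arbitrary, a step of Pascal's recursion is a change of \<open>f\<close>.\<close>

primrec gcol :: "'a::comm_ring_1 \<Rightarrow> 'a \<Rightarrow> nat \<Rightarrow> (nat \<Rightarrow> 'a \<Rightarrow> 'a) \<Rightarrow> 'a \<Rightarrow> 'a" where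
  "gcol u w 0 f t = u * f 0 t"
| "gcol u w (Suc c) f t = gcol u w c (\<lambda>a t. w * f a t + u * f (Suc a) t) t"

lemma gcol_power: "gcol u w c (\<lambda>a t. t ^ (N + a) * s t) t = u * t ^ N * s t * (w + u * t) ^ c"
proof (induction c arbitrary: s)
  case (Suc c)
  have "(\<lambda>a t. w * (t ^ (N + a) * s t) + u * (t ^ (N + Suc a) * s t)) = (\<lambda>a t. t ^ (N + a) * (s t * (w + u * t)))"
    by (simp add: fun_eq_iff algebra_simps)
  then show ?case using Suc[of "\<lambda>t. s t * (w + u * t)"] by (simp add: algebra_simps)
qed (simp add: algebra_simps)

definition array_weight :: "'a::comm_ring_1 \<Rightarrow> 'a \<Rightarrow> (nat \<Rightarrow> nat \<Rightarrow> nat) \<Rightarrow> 'a" where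
  "array_weight u w S = (\<Prod>i=1..num_rows S. u ^ row_len S i * w ^ (S i i - row_len S i))"

definition array_columns :: "(nat \<Rightarrow> 'a \<Rightarrow> 'a) \<Rightarrow> (nat \<Rightarrow> nat \<Rightarrow> nat) \<Rightarrow> ('a \<Rightarrow> 'a) list" where
  "array_columns f S = map (\<lambda>i. f (row_len S i - 1)) [1..<Suc (num_rows S)]"

text \<open>Position \<open>j\<close> stands for the column \<open>c = Suc j\<close>; the free ones
  keep their first summand.\<close>

definition free_positions :: "nat \<Rightarrow> (nat \<Rightarrow> nat \<Rightarrow> nat) \<Rightarrow> nat list" where
  "free_positions m S = filter (\<lambda>j. \<forall>i. S i i \<noteq> Suc j) [0..<m]"

context
  fixes m :: nat and S :: "nat \<Rightarrow> nat \<Rightarrow> nat"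
  assumes S: "S \<in> shifted_arrays m"
begin

abbreviation (input) "last_row \<equiv> Suc (num_rows S)"
abbreviation (input) "steps i \<equiv> {row_len S i, Suc (row_len S i)}"

lemma row_len_last: "row_len S last_row = 0"
  using row_len_pos_iff_rows[OF S, of last_row] by simp

lemma row_extensions_subset: "row_extensions (row_len S) \<subseteq> choices {1..last_row} steps"
proof
  fix r assume r: "r \<in> row_extensions (row_len S)"
  have "r i \<in> steps i" for i using extension_bounds[OF S r, of i] by auto
  moreover have "r i = 0" if "i \<notin> {1..last_row}" for i
    using extension_row_bound[OF S r, of i] that by (cases "r i = 0") auto
  ultimately show "r \<in> choices {1..last_row} steps" by (auto simp: choices_def)
qed

text \<open>The old lengths decrease strictly and each grows by at most one, so strictness can fail
  only through two equal neighbours. These will be two equal columns.\<close>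

lemma not_row_extension:
  assumes r: "r \<in> choices {1..last_row} steps" "r \<notin> row_extensions (row_len S)"
  obtains i where "1 \<le> i" "i \<le> num_rows S" "r (Suc i) = r i" "0 < r (Suc i)"
proof -
  have r_out: "r i = 0" if "i \<notin> {1..last_row}" for i using r(1) that by (simp add: choices_def)
  have bounds: "row_len S i \<le> r i \<and> r i \<le> Suc (row_len S i)" for i
  proof (cases "i \<in> {1..last_row}")
    case True
    then have "r i \<in> steps i" using r(1) by (simp add: choices_def)
    then show ?thesis by auto
  next
    case False
    then have "row_len S i = 0" using row_len_pos_iff_rows[OF S, of i] by auto
    then show ?thesis using r_out[OF False] by simp
  qed
  have "r 0 = 0" using r_out[of 0] by simp
  with r(2) bounds obtain i where i: "1 \<le> i" "0 < r (Suc i)" "\<not> r (Suc i) < r i"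
    by (auto simp: row_extensions_def)
  then have le: "i \<le> num_rows S" using r_out[of "Suc i"] by (cases "Suc i \<in> {1..last_row}") auto
  then have "0 < row_len S i" using i row_len_pos_iff_rows[OF S] by simp
  then have "row_len S (Suc i) < row_len S i" using row_len_strict[OF S i(1)] by (cases "row_len S (Suc i) = 0") auto
  then have "r (Suc i) = r i" using i(3) bounds[of i] bounds[of "Suc i"] by simp
  then show thesis using that i le by blast
qed

context
  fixes r assumes r: "r \<in> row_extensions (row_len S)"
begin

lemma raise_diag: "raise_array S r i i = (if 0 < r i then Suc (S i i) else 0)"
  using extension_0[OF S r] by (cases i) (auto simp: raise_array_def)

lemma extension_last_le: "r last_row \<le> 1"
  using extension_bounds(2)[OF S r, of last_row] row_len_last by simp

lemma num_rows_raise: "num_rows (raise_array S r) = (if r last_row = 0 then num_rows S else last_row)"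
proof -
  have "i \<le> num_rows (raise_array S r) \<longleftrightarrow> i \<le> (if r last_row = 0 then num_rows S else last_row)" if "1 \<le> i" for i
  proof -
    have "1 \<le> i \<and> i \<le> num_rows (raise_array S r) \<longleftrightarrow> 0 < r i"
      using row_len_pos_iff_rows[OF raise_array_shifted[OF S r], of i] by (simp add: row_len_raise_array[OF S r])
    moreover have "0 < r i" if "i \<le> num_rows S"
      using that \<open>1 \<le> i\<close> row_len_pos_iff_rows[OF S, of i] extension_bounds(1)[OF S r, of i] by simp
    ultimately show ?thesis
      using that extension_row_bound(2)[OF S r, of i] by (auto simp: le_Suc_eq)
  qed
  then show ?thesis by (rule nat_eqI_pos_le)
qed

text \<open>Raising increases the first entry of every old row: one of unchanged length gains
  \<open>w\<close>, a lengthened one \<open>u\<close>. A new row has length and entry 1 and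
  contributes \<open>u\<close>; its absence contributes 1, whence the exception at
  \<open>last_row\<close>.\<close>

lemma array_weight_raise:
  "array_weight u w (raise_array S r) =
    array_weight u w S * (\<Prod>i=1..last_row. if r i = row_len S i then (if i = last_row then 1 else w) else u)"
proof -
  let ?t = "\<lambda>i. u ^ r i * w ^ (raise_array S r i i - r i)"
  have "?t i = u ^ row_len S i * w ^ (S i i - row_len S i) * (if r i = row_len S i then w else u)"
    if i: "i \<in> {1..num_rows S}" for i
  proof -
    have pos: "0 < row_len S i" using i row_len_pos_iff_rows[OF S] by simp
    then have d: "raise_array S r i i = Suc (S i i)" using extension_bounds(1)[OF S r, of i] by (simp add: raise_diag)
    have "r i = row_len S i \<or> r i = Suc (row_len S i)" using extension_bounds[OF S r, of i] by auto
    then show ?thesis unfolding d using row_len_le_diag[OF S, of i] by (auto simp: Suc_diff_le algebra_simps)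
  qed
  then have 1: "(\<Prod>i=1..num_rows S. ?t i) = array_weight u w S * (\<Prod>i=1..num_rows S. if r i = row_len S i then w else u)"
    unfolding array_weight_def prod.distrib[symmetric] by (intro prod.cong refl) auto
  have 2: "(\<Prod>i=1..num_rows S. if r i = row_len S i then w else u) =
     (\<Prod>i=1..num_rows S. if r i = row_len S i then (if i = last_row then 1 else w) else u)"
    by (intro prod.cong refl) auto
  show ?thesis
  proof (cases "r last_row = 0")
    case True
    then show ?thesis
      using 1 2 row_len_last by (simp add: array_weight_def[of u w "raise_array S r"] num_rows_raise row_len_raise_array[OF S r])
  next
    case False
    then have "r last_row = 1" using extension_last_le by simp
    moreover have "S last_row last_row = 0" using diag_pos_iff_rows[OF S, of last_row] by simp
    ultimately show ?thesis
      using 1 2 row_len_last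
      by (simp add: array_weight_def[of u w "raise_array S r"] num_rows_raise row_len_raise_array[OF S r] raise_diag)
  qed
qed

text \<open>All occupied positions move up by one, and 0 becomes occupied exactly when a new row,
  with entry 1, appears.\<close>

lemma free_positions_raise:
  "free_positions (Suc m) (raise_array S r) =
    (if r last_row = 0 then 0 # map Suc (free_positions m S) else map Suc (free_positions m S))"
proof -
  have one: "(\<forall>i. raise_array S r i i \<noteq> Suc 0) \<longleftrightarrow> r last_row = 0"
  proof
    assume *: "\<forall>i. raise_array S r i i \<noteq> Suc 0"
    have "S last_row last_row = 0" using diag_pos_iff_rows[OF S, of last_row] by simp
    then show "r last_row = 0" using *[rule_format, of last_row] by (simp add: raise_diag split: if_splits)
  next
    assume last: "r last_row = 0"
    show "\<forall>i. raise_array S r i i \<noteq> Suc 0"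
    proof (rule allI, rule notI)
      fix i assume "raise_array S r i i = Suc 0"
      then have i: "0 < r i" "S i i = 0" by (auto simp: raise_diag split: if_splits)
      then have "num_rows S < i" using diag_pos_iff_rows[OF S, of i] extension_row_bound(1)[OF S r] by auto
      then have "i = last_row" using extension_row_bound(2)[OF S r, of i] i by simp
      then show False using i last by simp
    qed
  qed
  have "raise_array S r i i = Suc (Suc j) \<longleftrightarrow> S i i = Suc j" for i j
  proof -
    have "0 < r i" if "S i i = Suc j"
      using that diag_pos_iff[OF S, of i] extension_bounds(1)[OF S r, of i] by simp
    then show ?thesis by (auto simp: raise_diag)
  qed
  then have "filter (\<lambda>j. \<forall>i. raise_array S r i i \<noteq> Suc j) (map Suc [0..<m]) = map Suc (free_positions m S)"
    by (simp add: filter_map free_positions_def comp_def)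
  moreover have "[0..<Suc m] = 0 # map Suc [0..<m]" by (simp add: upt_conv_Cons map_Suc_upt del: upt_Suc)
  ultimately show ?thesis by (simp add: free_positions_def[of "Suc m"] one del: upt_Suc)
qed

end

text \<open>Pascal's recursion in the columns matches the addition of the entries 1 to the array; the
  choices of row lengths that do not give a shifted array produce two equal columns.\<close>

lemma list_alt_raise:
  fixes u w :: "'a::comm_ring_1" and x :: "nat \<Rightarrow> 'a"
  shows "array_weight u w S * list_alt (array_columns (\<lambda>a t. w * f a t + u * f (Suc a) t) S @
      (Z @ [\<lambda>t. h 0 t + (- 1) ^ length Z * (u * f 0 t)]) @ map (\<lambda>j. h (Suc j)) (free_positions m S)) x =
    (\<Sum>r\<in>row_extensions (row_len S). array_weight u w (raise_array S r) *
      list_alt (array_columns f (raise_array S r) @ Z @ map h (free_positions (Suc m) (raise_array S r))) x)"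
proof -
  let ?l = "num_rows S"
  let ?R = "map (\<lambda>j. h (Suc j)) (free_positions m S)"
  let ?A = "\<lambda>r. map (\<lambda>i. f (r i - 1)) [1..<Suc ?l]"
  define c where "c i e = (if e = row_len S i then (if i = last_row then 1 else w) else u)" for i e
  \<comment> \<open>\<open>L r\<close> makes sense for every choice, also where no shifted array
    results, so the multilinear expansion is summed before terms are discarded.\<close>
  define L where "L r = map (\<lambda>i. f (r i - 1)) [1..<Suc (if r last_row = 0 then ?l else last_row)] @ Z @
     (if r last_row = 0 then h 0 # ?R else ?R)" for r
  have cols: "array_columns (\<lambda>a t. w * f a t + u * f (Suc a) t) S =
     map (\<lambda>i t. \<Sum>e\<in>steps i. c i e * f (e - 1) t) [1..<Suc ?l]"
    unfolding array_columns_def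
  proof (rule map_cong[OF refl])
    fix i assume "i \<in> set [1..<Suc ?l]"
    then have i: "1 \<le> i" "i \<le> ?l" by auto
    then obtain d where "row_len S i = Suc d"
      using row_len_pos_iff_rows[OF S, of i] by (metis gr0_implies_Suc)
    then show "(\<lambda>t. w * f (row_len S i - 1) t + u * f (Suc (row_len S i - 1)) t) =
      (\<lambda>t. \<Sum>e\<in>steps i. c i e * f (e - 1) t)" using i by (simp add: c_def fun_eq_iff)
  qed
  have "list_alt (array_columns (\<lambda>a t. w * f a t + u * f (Suc a) t) S @
      (Z @ [\<lambda>t. h 0 t + (- 1) ^ length Z * (u * f 0 t)]) @ ?R) x =
    (\<Sum>r\<in>choices {1..?l} steps. (\<Prod>i=1..?l. c i (r i)) *
       list_alt (?A r @ Z @ (\<lambda>t. h 0 t + (- 1) ^ length Z * (u * f 0 t)) # ?R) x)"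
    unfolding cols
    using list_alt_expand[of "[1..<Suc ?l]" steps "[]" c "\<lambda>i e. f (e - 1)"
        "Z @ (\<lambda>t. h 0 t + (- 1) ^ length Z * (u * f 0 t)) # ?R" x]
    by (simp add: atLeastLessThanSuc_atLeastAtMost del: upt_Suc)
  also have "\<dots> = (\<Sum>r\<in>choices {1..?l} steps. \<Sum>e\<in>{0, 1}. (\<Prod>i=1..last_row. c i ((r(last_row := e)) i)) * list_alt (L (r(last_row := e))) x)"
  proof (intro sum.cong refl)
    fix r assume "r \<in> choices {1..?l} steps"
    have upd: "?A (r(last_row := e)) = ?A r" for e by (intro map_cong refl) auto
    have prod: "(\<Prod>i=1..last_row. c i ((r(last_row := e)) i)) = (\<Prod>i=1..?l. c i (r i)) * c last_row e" for e
    proof -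
      have "(\<Prod>i=1..?l. c i ((r(last_row := e)) i)) = (\<Prod>i=1..?l. c i (r i))" by (intro prod.cong) auto
      then show ?thesis by simp
    qed
    have c: "c last_row 0 = 1" "c last_row 1 = u" by (simp_all add: c_def row_len_last)
    have L0: "L (r(last_row := 0)) = ?A r @ Z @ h 0 # ?R"
      unfolding L_def using upd[of 0] by simp
    have L1: "L (r(last_row := 1)) = ?A r @ f 0 # Z @ ?R"
      unfolding L_def using upd[of 1] by simp
    \<comment> \<open>Where \<open>f 0\<close> is chosen, it moves left past \<open>Z\<close> and
      becomes the column of a new last row; the sign of this move cancels the sign in front of
      it.\<close>
    have "list_alt (?A r @ Z @ (\<lambda>t. h 0 t + ((- 1) ^ length Z * u) * f 0 t) # ?R) x =
       list_alt (?A r @ Z @ h 0 # ?R) x + ((- 1) ^ length Z * u) * list_alt (?A r @ Z @ f 0 # ?R) x"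
      using list_alt_add[of "?A r @ Z" "h 0" "(- 1) ^ length Z * u" "f 0" ?R x] by (simp only: append_assoc)
    also have "\<dots> = list_alt (?A r @ Z @ h 0 # ?R) x + u * list_alt (?A r @ f 0 # Z @ ?R) x"
    proof -
      have "(- 1) ^ length Z * (- 1) ^ length Z = (1::'a)" by (simp flip: power_mult_distrib)
      then show ?thesis using list_alt_move[of "?A r" Z "f 0" ?R x] by (simp add: mult.assoc mult.left_commute)
    qed
    finally show "(\<Prod>i=1..?l. c i (r i)) * list_alt (?A r @ Z @ (\<lambda>t. h 0 t + (- 1) ^ length Z * (u * f 0 t)) # ?R) x =
      (\<Sum>e\<in>{0, 1}. (\<Prod>i=1..last_row. c i ((r(last_row := e)) i)) * list_alt (L (r(last_row := e))) x)"
      by (simp only: prod) (simp add: L0 L1[unfolded One_nat_def] c[unfolded One_nat_def] algebra_simps)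
  qed
  \<comment> \<open>The alternative between \<open>h 0\<close> and \<open>f 0\<close> is read as
    length 0 or 1 of the possible new row.\<close>
  also have "\<dots> = (\<Sum>r\<in>choices {1..last_row} steps. (\<Prod>i=1..last_row. c i (r i)) * list_alt (L r) x)"
  proof -
    have "{1..last_row} = insert last_row {1..?l}" by auto
    moreover have "steps last_row = {0, 1}" by (simp add: row_len_last)
    ultimately show ?thesis
      using sum_choices_insert[of "{1..?l}" last_row steps "\<lambda>r. (\<Prod>i=1..last_row. c i (r i)) * list_alt (L r) x"]
      by (subst sum.swap) simp
  qed
  also have "\<dots> = (\<Sum>r\<in>row_extensions (row_len S). (\<Prod>i=1..last_row. c i (r i)) * list_alt (L r) x)"
  proof (rule sum.mono_neutral_right)
    show "finite (choices {1..last_row} steps)" by (rule finite_choices) auto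
    show "row_extensions (row_len S) \<subseteq> choices {1..last_row} steps" by (rule row_extensions_subset)
    show "\<forall>r\<in>choices {1..last_row} steps - row_extensions (row_len S). (\<Prod>i=1..last_row. c i (r i)) * list_alt (L r) x = 0"
    proof
      fix r assume "r \<in> choices {1..last_row} steps - row_extensions (row_len S)"
      then obtain i where i: "1 \<le> i" "i \<le> ?l" "r (Suc i) = r i" "0 < r (Suc i)"
        using not_row_extension[of r] by blast
      define N where "N = (if r last_row = 0 then ?l else last_row)"
      \<comment> \<open>Column \<open>Suc i\<close> is present even if it belongs to the new row,
        whose length is then positive.\<close>
      have "Suc i \<le> N" using i by (cases "i = ?l") (auto simp: N_def)
      then have "list_alt (L r) x = 0"
        using i unfolding L_def N_def[symmetric]
        by (intro list_alt_eq_columns[of "i - 1" _ i]) (auto simp: nth_append simp del: upt_Suc)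
      then show "(\<Prod>i=1..last_row. c i (r i)) * list_alt (L r) x = 0" by simp
    qed
  qed
  finally have "array_weight u w S * list_alt (array_columns (\<lambda>a t. w * f a t + u * f (Suc a) t) S @
      (Z @ [\<lambda>t. h 0 t + (- 1) ^ length Z * (u * f 0 t)]) @ ?R) x =
    (\<Sum>r\<in>row_extensions (row_len S). array_weight u w S * ((\<Prod>i=1..last_row. c i (r i)) * list_alt (L r) x))"
    by (simp only: sum_distrib_left)
  also have "\<dots> = (\<Sum>r\<in>row_extensions (row_len S). array_weight u w (raise_array S r) *
      list_alt (array_columns f (raise_array S r) @ Z @ map h (free_positions (Suc m) (raise_array S r))) x)"
  proof (intro sum.cong refl)
    fix r assume r: "r \<in> row_extensions (row_len S)"
    have "L r = array_columns f (raise_array S r) @ Z @ map h (free_positions (Suc m) (raise_array S r))"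
      by (simp add: L_def array_columns_def num_rows_raise[OF r] row_len_raise_array[OF S r] free_positions_raise[OF r] comp_def)
    then show "array_weight u w S * ((\<Prod>i=1..last_row. c i (r i)) * list_alt (L r) x) =
      array_weight u w (raise_array S r) *
      list_alt (array_columns f (raise_array S r) @ Z @ map h (free_positions (Suc m) (raise_array S r))) x"
      unfolding array_weight_raise[OF r] c_def by (simp only: mult.assoc)
  qed
  finally show ?thesis .
qed

end

text \<open>The exponent \<open>length Z + j\<close> counts the columns left of column
  \<open>j\<close>, hence the exchanges that bring it to the front. The induction hypothesis expands
  all columns after the first, which joins \<open>Z\<close>, with \<open>f\<close> replaced by its
  Pascal combination; \<open>list_alt_raise\<close> then splits the first.\<close>

theorem list_alt_shifted_expansion:
  fixes u w :: "'a::comm_ring_1" and x :: "nat \<Rightarrow> 'a"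
  shows "list_alt (Z @ map (\<lambda>j t. h j t + (- 1) ^ (length Z + j) * gcol u w j f t) [0..<m]) x =
    (\<Sum>S\<in>shifted_arrays m. array_weight u w S *
      list_alt (array_columns f S @ Z @ map h (free_positions m S)) x)"
proof (induction m arbitrary: Z h f)
  case 0
  have "num_rows (\<lambda>_ _. 0) = 0" by (simp add: num_rows_def)
  then show ?case by (simp add: shifted_arrays_0 array_weight_def array_columns_def free_positions_def)
next
  case (Suc m)
  let ?h0 = "\<lambda>t. h 0 t + (- 1) ^ length Z * (u * f 0 t)"
  let ?f = "\<lambda>a t. w * f a t + u * f (Suc a) t"
  have upt: "[0..<Suc m] = 0 # map Suc [0..<m]" by (simp add: upt_conv_Cons map_Suc_upt del: upt_Suc)
  have "Z @ map (\<lambda>j t. h j t + (- 1) ^ (length Z + j) * gcol u w j f t) [0..<Suc m] =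
     (Z @ [?h0]) @ map (\<lambda>j t. h (Suc j) t + (- 1) ^ (length (Z @ [?h0]) + j) * gcol u w j ?f t) [0..<m]"
    unfolding upt by (simp add: comp_def)
  then have "list_alt (Z @ map (\<lambda>j t. h j t + (- 1) ^ (length Z + j) * gcol u w j f t) [0..<Suc m]) x =
    (\<Sum>S\<in>shifted_arrays m. array_weight u w S *
      list_alt (array_columns ?f S @ (Z @ [?h0]) @ map (\<lambda>j. h (Suc j)) (free_positions m S)) x)"
    using Suc.IH[of "Z @ [?h0]" "\<lambda>j. h (Suc j)" ?f] by (simp only:)
  also have "\<dots> = (\<Sum>S\<in>shifted_arrays m. \<Sum>r\<in>row_extensions (row_len S). array_weight u w (raise_array S r) *
      list_alt (array_columns f (raise_array S r) @ Z @ map h (free_positions (Suc m) (raise_array S r))) x)"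
    by (intro sum.cong refl list_alt_raise)
  finally show ?case unfolding sum_shifted_arrays_Suc .
qed

subsection \<open>Frobenius notation\<close>

lemma antimono_upto:
  fixes g :: "nat \<Rightarrow> nat"
  assumes "\<And>i. 1 \<le> i \<Longrightarrow> Suc i \<le> l \<Longrightarrow> g (Suc i) \<le> g i" "1 \<le> i" "i \<le> j" "j \<le> l"
  shows "g j \<le> g i"
  using assms(3,4)
proof (induction j rule: dec_induct)
  case (step j)
  then show ?case using assms(1)[of j] assms(2) by simp
qed simp

locale frobenius =
  fixes l :: nat and a c :: "nat \<Rightarrow> nat"
  assumes a_strict: "\<And>i. 1 \<le> i \<Longrightarrow> Suc i \<le> l \<Longrightarrow> a (Suc i) < a i"
    and c_strict: "\<And>i. 1 \<le> i \<Longrightarrow> Suc i \<le> l \<Longrightarrow> c (Suc i) < c i"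
begin

abbreviation "lam \<equiv> frob_part l a c"

lemma a_antimono: "1 \<le> i \<Longrightarrow> i \<le> j \<Longrightarrow> j \<le> l \<Longrightarrow> a j + j \<le> a i + i"
  using antimono_upto[of l "\<lambda>i. a i + i"] a_strict by (simp add: less_eq_Suc_le)

lemma c_antimono: "1 \<le> i \<Longrightarrow> i \<le> j \<Longrightarrow> j \<le> l \<Longrightarrow> c j + j \<le> c i + i"
  using antimono_upto[of l "\<lambda>i. c i + i"] c_strict by (simp add: less_eq_Suc_le)

lemma lam_small: "1 \<le> i \<Longrightarrow> i \<le> l \<Longrightarrow> lam i = a i + i"
  by (simp add: frob_part_def)

text \<open>Below the Durfee square a row counts the columns that reach it, and these form an
  initial segment because the column lengths \<open>c j + j\<close> decrease weakly.\<close>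

lemma le_lam_iff:
  assumes "l < i" "1 \<le> j" "j \<le> l"
  shows "j \<le> lam i \<longleftrightarrow> i \<le> c j + j"
proof -
  let ?J = "{j \<in> {1..l}. i \<le> c j + j}"
  have "?J = {1..card ?J}"
  proof (rule initial_segment_eq)
    fix j assume "1 \<le> j" "Suc j \<in> ?J"
    then show "j \<in> ?J" using c_antimono[of j "Suc j"] by auto
  qed auto
  then have "j \<in> ?J \<longleftrightarrow> j \<in> {1..card ?J}" by simp
  then show ?thesis using assms by (simp add: frob_part_def)
qed

lemma lam_large_le: "l < i \<Longrightarrow> lam i \<le> l"
proof -
  assume "l < i"
  moreover have "card {j \<in> {1..l}. i \<le> c j + j} \<le> card {1..l}" by (rule card_mono) auto
  ultimately show ?thesis by (simp add: frob_part_def)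
qed

lemma durfee_lam: "durfee lam = l"
proof -
  have "i \<le> lam i \<longleftrightarrow> i \<le> l" if "1 \<le> i" for i
    using that lam_large_le[of i] lam_small[of i] by (cases "i \<le> l") auto
  then have "{i. 1 \<le> i \<and> i \<le> lam i} = {1..l}" by auto
  then show ?thesis by (simp add: durfee_def)
qed

lemma frob_a_lam: "1 \<le> i \<Longrightarrow> i \<le> l \<Longrightarrow> frob_a lam i = a i"
  by (simp add: frob_a_def lam_small)

lemma frob_b_lam:
  assumes i: "1 \<le> i" "i \<le> l"
  shows "frob_b lam i = c i"
proof -
  have "i \<le> lam k \<longleftrightarrow> k \<le> c i + i" if "1 \<le> k" for k
  proof (cases "k \<le> l")
    case True
    have "l \<le> lam k" using a_antimono[of k l] that True by (simp add: lam_small)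
    moreover have "l \<le> c i + i" using c_antimono[of i l] i by simp
    ultimately show ?thesis using True i by simp
  next
    case False
    then show ?thesis using le_lam_iff[of k i] i by simp
  qed
  then have "{k. 1 \<le> k \<and> i \<le> lam k} = {1..c i + i}" by auto
  then show ?thesis by (simp add: frob_b_def conj_part_def)
qed

lemma partition_lam:
  assumes "\<And>i. 1 \<le> i \<Longrightarrow> i \<le> l \<Longrightarrow> c i + i \<le> n"
  shows "partition_upto n lam"
  unfolding partition_upto_def
proof (intro conjI allI impI)
  fix i :: nat assume i: "1 \<le> i"
  consider "Suc i \<le> l" | "i = l" | "l < i" by linarith
  then show "lam (Suc i) \<le> lam i"
  proof cases
    case 1
    then show ?thesis using i a_antimono[of i "Suc i"] by (simp add: lam_small)
  next
    case 2
    then show ?thesis using i lam_large_le[of "Suc i"] by (simp add: lam_small)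
  next
    case 3
    then show ?thesis unfolding frob_part_def by (auto intro!: card_mono)
  qed
next
  fix i assume i: "n < i"
  have "l < i"
  proof (cases "l = 0")
    case False
    then show ?thesis using assms[of l] i by simp
  qed (use i in simp)
  moreover have "{j \<in> {1..l}. i \<le> c j + j} = {}" using assms i by fastforce
  ultimately show "lam i = 0" by (simp add: frob_part_def del: One_nat_def)
qed

end

section \<open>Frobenius notation of the diagonal of a totally symmetric plane partition\<close>

context
  fixes m :: nat and T :: "nat \<Rightarrow> nat \<Rightarrow> nat"
  assumes T: "T \<in> TSPP m"
begin

abbreviation (input) "arr \<equiv> tspp_array T"

lemma TSPP_zero: "\<not> (i \<in> {1..m} \<and> j \<in> {1..m}) \<Longrightarrow> T i j = 0"
  using T unfolding TSPP_def by blast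

lemma TSPP_diag_antimono:
  assumes "1 \<le> i"
  shows "T (Suc i) (Suc i) \<le> T i i"
proof (cases "Suc i \<in> {1..m}")
  case True
  then have "T (i + 1) (i + 1) \<le> T i (i + 1)" "T i (i + 1) \<le> T i i"
    using T assms unfolding TSPP_def by auto
  then show ?thesis by simp
qed (simp add: TSPP_zero)

lemma le_diag_part_iff:
  assumes "1 \<le> i" "1 \<le> j"
  shows "i \<le> diag_part m T j \<longleftrightarrow> j \<le> T i i"
proof -
  let ?J = "{i. 1 \<le> i \<and> j \<le> T i i}"
  have "(if i \<in> {1..m} then T i i else 0) = T i i" for i using TSPP_zero[of i i] by auto
  then have d: "diag_part m T j = card ?J" by (simp only: diag_part_def conj_part_def)
  have "?J = {1..card ?J}"
  proof (rule initial_segment_eq)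
    show "finite ?J"
    proof (rule finite_subset)
      show "?J \<subseteq> {1..m}"
      proof
        fix i assume "i \<in> ?J"
        then show "i \<in> {1..m}" using TSPP_zero[of i i] assms(2) by (cases "i \<in> {1..m}") auto
      qed
    qed simp
    fix i assume "1 \<le> i" "Suc i \<in> ?J"
    then show "i \<in> ?J" using TSPP_diag_antimono[of i] by simp
  qed simp
  then have "i \<in> ?J \<longleftrightarrow> i \<in> {1..card ?J}" by simp
  then show ?thesis using assms d by simp
qed

lemma arr_diag: "1 \<le> i \<Longrightarrow> arr i i = Suc (T i i) - i"
  by (simp add: tspp_array_def)

lemma durfee_diag_part: "durfee (diag_part m T) = num_rows arr"
proof -
  have "1 \<le> i \<and> i \<le> diag_part m T i \<longleftrightarrow> 0 < arr i i" for i
    using le_diag_part_iff[of i i] arr_diag[of i] by (cases "i = 0") (auto simp: tspp_array_def)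
  then show ?thesis by (simp add: durfee_def num_rows_def)
qed

text \<open>Conjugating twice returns the diagonal of \<open>T\<close>, so the leg is
  \<open>T i i - i\<close>; the 1 added in \<open>pi_part\<close> makes it the array entry.\<close>

lemma frob_b_diag_part:
  assumes "1 \<le> i" "i \<le> num_rows arr"
  shows "frob_b (diag_part m T) i + 1 = arr i i"
proof -
  have "{j. 1 \<le> j \<and> i \<le> diag_part m T j} = {1..T i i}"
    using le_diag_part_iff[OF assms(1)] by auto
  moreover have "0 < arr i i" using diag_pos_iff_rows[OF tspp_array_shifted[OF T]] assms by simp
  ultimately show ?thesis using arr_diag[OF assms(1)] by (simp add: frob_b_def conj_part_def)
qed

text \<open>Total symmetry enters: for \<open>i \<le> k\<close>, \<open>i \<le> T k k\<close> says
  that (k, k, i) is a cell, equivalently (i, k, k), and this means that the array entry in row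
  \<open>i\<close>, column \<open>k\<close> is positive.\<close>

lemma frob_a_diag_part:
  assumes i: "1 \<le> i" "i \<le> num_rows arr"
  shows "frob_a (diag_part m T) i = row_len arr i - 1"
proof -
  note S = tspp_array_shifted[OF T]
  have pos: "0 < row_len arr i" using row_len_pos_iff_rows[OF S] i by simp
  have ge: "k \<le> diag_part m T i \<longleftrightarrow> k < i + row_len arr i" if "i \<le> k" for k
  proof -
    have k: "1 \<le> k" using that i by simp
    have "k \<le> diag_part m T i \<longleftrightarrow> i \<le> T k k" by (rule le_diag_part_iff[OF k i(1)])
    also have "\<dots> \<longleftrightarrow> (k, k, i) \<in> pp_set m T"
      using TSPP_zero[of k k] i by (cases "k \<in> {1..m}") (auto simp: pp_set_def)
    also have "\<dots> \<longleftrightarrow> 0 < arr i k"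
      unfolding TSPP_cell_iff[OF T] using that i by (simp add: array_cell_def sort3_defs min_def max_def)
    finally show ?thesis using shifted_pos_iff[OF S, of i k] that i by simp
  qed
  have "diag_part m T i = i - 1 + row_len arr i"
  proof (rule nat_eqI_pos_le)
    fix k :: nat assume "1 \<le> k"
    have "i \<le> diag_part m T i" using ge[of i] pos by simp
    then show "k \<le> diag_part m T i \<longleftrightarrow> k \<le> i - 1 + row_len arr i"
      using ge[of k] i pos by (cases "i \<le> k") auto
  qed
  then show ?thesis using pos i by (simp add: frob_a_def)
qed

lemma pi_part_eq: "pi_part m T = frob_part (num_rows arr) (\<lambda>i. row_len arr i - 1) (\<lambda>i. arr i i)"
proof
  fix i
  have "{j \<in> {1..num_rows arr}. i \<le> frob_b (diag_part m T) j + 1 + j} = {j \<in> {1..num_rows arr}. i \<le> arr j j + j}"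
    by (intro Collect_cong conj_cong refl) (simp only: frob_b_diag_part atLeastAtMost_iff)
  then show "pi_part m T i = frob_part (num_rows arr) (\<lambda>i. row_len arr i - 1) (\<lambda>i. arr i i) i"
    using frob_a_diag_part[of i] by (simp add: pi_part_def Let_def frob_part_def durfee_diag_part)
qed

end

subsection \<open>The columns attached to a shifted array\<close>

context
  fixes m :: nat and S :: "nat \<Rightarrow> nat \<Rightarrow> nat"
  assumes S: "S \<in> shifted_arrays m"
begin

lemma frobenius_array: "frobenius (num_rows S) (\<lambda>i. row_len S i - 1) (\<lambda>i. S i i)"
proof
  fix i assume i: "1 \<le> i" "Suc i \<le> num_rows S"
  then have "0 < row_len S (Suc i)" "0 < S (Suc i) (Suc i)"
    using row_len_pos_iff_rows[OF S] diag_pos_iff_rows[OF S] by auto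
  then show "row_len S (Suc i) - 1 < row_len S i - 1" "S (Suc i) (Suc i) < S i i"
    using row_len_strict[OF S i(1)] diag_strict[OF S i(1)] by auto
qed

abbreviation (input) "shape \<equiv> frob_part (num_rows S) (\<lambda>i. row_len S i - 1) (\<lambda>i. S i i)"

interpretation frobenius "num_rows S" "\<lambda>i. row_len S i - 1" "\<lambda>i. S i i"
  by (rule frobenius_array)

lemma row_pos: "1 \<le> i \<Longrightarrow> i \<le> num_rows S \<Longrightarrow> 0 < row_len S i \<and> 0 < S i i"
  using row_len_pos_iff_rows[OF S] diag_pos_iff_rows[OF S] by auto

lemma diag_bound: "1 \<le> i \<Longrightarrow> i \<le> num_rows S \<Longrightarrow> S i i + i \<le> Suc m"
  using shifted_bounds[OF S, of i i] row_pos[of i] by simp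

lemma diag_less: "1 \<le> i \<Longrightarrow> i < j \<Longrightarrow> j \<le> num_rows S \<Longrightarrow> S j j < S i i"
  using c_antimono[of i j] by simp

lemma row_len_less: "1 \<le> i \<Longrightarrow> i < j \<Longrightarrow> j \<le> num_rows S \<Longrightarrow> row_len S j < row_len S i"
  using a_antimono[of i j] row_pos[of i] row_pos[of j] by simp

lemma inj_diag: "inj_on (\<lambda>i. S i i - 1) {1..num_rows S}"
proof (rule linorder_inj_onI)
  fix i j assume ij: "i < j" "i \<in> {1..num_rows S}" "j \<in> {1..num_rows S}"
  then show "S i i - 1 \<noteq> S j j - 1" using diag_less[of i j] row_pos[of j] by auto
qed auto

lemma set_free_positions: "set (free_positions m S) = {..<m} - (\<lambda>i. S i i - 1) ` {1..num_rows S}"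
proof -
  have "(\<exists>i. S i i = Suc j) \<longleftrightarrow> j \<in> (\<lambda>i. S i i - 1) ` {1..num_rows S}" for j
  proof
    assume "\<exists>i. S i i = Suc j"
    then obtain i where i: "S i i = Suc j" by blast
    then have "i \<in> {1..num_rows S}" using diag_pos_iff_rows[OF S, of i] by simp
    then show "j \<in> (\<lambda>i. S i i - 1) ` {1..num_rows S}" using i by (intro image_eqI[of _ _ i]) auto
  next
    assume "j \<in> (\<lambda>i. S i i - 1) ` {1..num_rows S}"
    then obtain i where "i \<in> {1..num_rows S}" "j = S i i - 1" by blast
    then have "S i i = Suc j" using row_pos[of i] by auto
    then show "\<exists>i. S i i = Suc j" by blast
  qed
  then show ?thesis by (auto simp: free_positions_def)
qed

lemma diag_image_subset: "(\<lambda>i. S i i - 1) ` {1..num_rows S} \<subseteq> {..<m}"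
proof (rule image_subsetI)
  fix i assume "i \<in> {1..num_rows S}"
  then show "S i i - 1 \<in> {..<m}" using diag_bound[of i] row_pos[of i] by auto
qed

lemma length_free_positions: "length (free_positions m S) + num_rows S = m"
proof -
  have "length (free_positions m S) = card (set (free_positions m S))"
    by (rule distinct_card[symmetric]) (simp add: free_positions_def)
  also have "\<dots> = m - num_rows S"
    unfolding set_free_positions using diag_image_subset
    by (subst card_Diff_subset) (simp_all add: card_image[OF inj_diag] del: One_nat_def)
  finally show ?thesis using num_rows_le[OF S] by simp
qed

text \<open>A free column \<open>Suc j\<close> contributes \<open>v ^ Suc j\<close>, and the
  exponents of all columns add up to the binomial coefficient; this is the power of \<open>v\<close>
  in \<open>omega\<close>.\<close>

lemma sum_free_positions:
  "(\<Sum>j\<in>set (free_positions m S). Suc j) = (Suc m choose 2) - (\<Sum>i=1..num_rows S. S i i)"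
proof -
  have "(\<Sum>j\<in>set (free_positions m S). Suc j) = (\<Sum>j<m. Suc j) - (\<Sum>j\<in>(\<lambda>i. S i i - 1) ` {1..num_rows S}. Suc j)"
    unfolding set_free_positions by (rule sum_diff_nat) (use diag_image_subset in auto)
  also have "(\<Sum>j\<in>(\<lambda>i. S i i - 1) ` {1..num_rows S}. Suc j) = (\<Sum>i=1..num_rows S. S i i)"
    unfolding sum.reindex[OF inj_diag] by (intro sum.cong refl) (use row_pos in auto)
  also have "(\<Sum>j<m. Suc j) = Suc m choose 2"
    by (induction m) (simp_all add: numeral_2_eq_2)
  finally show ?thesis .
qed

lemma partition_shape: "partition_upto (Suc m) shape"
  by (rule partition_lam) (rule diag_bound)

section \<open>Sorted exponents and the resulting alternant\<close>

definition "array_exponents = map (\<lambda>i. m + row_len S i) [1..<Suc (num_rows S)] @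
  m # map (\<lambda>j. m - Suc j) (free_positions m S)"

lemma array_exponents_sorted: "sorted_wrt (>) array_exponents"
proof -
  have "sorted_wrt (\<lambda>i j. m + row_len S i > m + row_len S j) [1..<Suc (num_rows S)]"
    by (rule sorted_wrt_mono_rel[OF _ sorted_wrt_upt]) (auto intro: row_len_less)
  moreover have "sorted_wrt (\<lambda>i j. m - Suc i > m - Suc j) (free_positions m S)"
  proof (rule sorted_wrt_mono_rel)
    show "sorted_wrt (<) (free_positions m S)"
      unfolding free_positions_def by (rule sorted_wrt_filter) simp
  qed (auto simp: free_positions_def)
  moreover have "m < m + row_len S i" if "i \<in> set [1..<Suc (num_rows S)]" for i
    using row_pos[of i] that by auto
  moreover have "m - Suc j < m" if "j \<in> set (free_positions m S)" for j
    using that by (auto simp: free_positions_def)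
  ultimately show ?thesis
    unfolding array_exponents_def sorted_wrt_append sorted_wrt.simps sorted_wrt_map
    by (auto simp: free_positions_def simp del: upt_Suc intro: diff_less less_trans le_less_trans)
qed

text \<open>The exponents \<open>lam i + n - i\<close> of a partition \<open>(a | c)\<close> are \<open>n + a i\<close> and the
  numbers below \<open>n\<close> other than \<open>n - 1 - c i\<close>.\<close>

lemma array_exponents_eq: "array_exponents = map (\<lambda>i. shape i + Suc m - i) [1..<Suc (Suc m)]"
proof -
  let ?E = "map (\<lambda>i. shape i + Suc m - i) [1..<Suc (Suc m)]"
  have anti: "shape j \<le> shape i" if "1 \<le> i" "i \<le> j" for i j
    using antimono_upto[of j shape i j] partition_shape that by (auto simp: partition_upto_def)
  have sorted: "sorted_wrt (>) ?E"
    unfolding sorted_wrt_map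
  proof (rule sorted_wrt_mono_rel[OF _ sorted_wrt_upt])
    fix i j assume "i \<in> set [1..<Suc (Suc m)]" "j \<in> set [1..<Suc (Suc m)]" "i < j"
    then show "shape j + Suc m - j < shape i + Suc m - i" using anti[of i j] by auto
  qed
  have "shape i + Suc m - i \<in> set array_exponents" if i: "1 \<le> i" "i \<le> Suc m" for i
  proof (cases "i \<le> num_rows S")
    case True
    then have "shape i + Suc m - i = m + row_len S i" using i row_pos[of i] lam_small[of i] by simp
    moreover have "i \<in> set [1..<Suc (num_rows S)]" using True i by auto
    ultimately show ?thesis by (simp add: array_exponents_def del: upt_Suc set_upt)
  next
    case False
    define e where "e = shape i + Suc m - i"
    have small: "shape i < i" using lam_large_le[of i] False by simp
    then have em: "m - e = i - 1 - shape i" "e \<le> m" using i by (auto simp: e_def)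
    show ?thesis
    proof (cases "e = m")
      case False
      define j where "j = m - Suc e"
      have j: "e = m - Suc j" "j < m" using False em by (auto simp: j_def)
      \<comment> \<open>If row \<open>k\<close> occupied \<open>j\<close>, then
        \<open>le_lam_iff\<close> would make \<open>k \<le> shape i\<close> equivalent to
        \<open>shape i < k\<close>.\<close>
      have "S k k \<noteq> Suc j" for k
      proof
        assume k: "S k k = Suc j"
        then have "1 \<le> k" "k \<le> num_rows S" using diag_pos_iff_rows[OF S, of k] by auto
        moreover have "S k k = i - 1 - shape i" using k j em by simp
        ultimately show False using le_lam_iff[of i k] \<open>\<not> i \<le> num_rows S\<close> small by auto
      qed
      then have "j \<in> set (free_positions m S)" using j by (simp add: free_positions_def)
      then show ?thesis using j by (auto simp: array_exponents_def e_def)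
    qed (simp add: array_exponents_def e_def)
  qed
  \<comment> \<open>Both lists decrease strictly and have the same length, so an inclusion of sets
    is enough.\<close>
  then have sub: "set ?E \<subseteq> set array_exponents" by (auto simp del: upt_Suc)
  have "length array_exponents = Suc m" "length ?E = Suc m"
    using length_free_positions by (simp_all add: array_exponents_def)
  moreover have "distinct xs" if "sorted_wrt (>) xs" for xs :: "nat list"
    using that by (induction xs) auto
  then have "distinct array_exponents" "distinct ?E"
    using array_exponents_sorted sorted by blast+
  ultimately have "card (set ?E) = card (set array_exponents)" by (simp only: distinct_card)
  then have "set ?E = set array_exponents" by (intro card_subset_eq[OF _ sub]) simp
  then have "rev ?E = rev array_exponents"
    using sorted array_exponents_sorted by (intro strict_sorted_equal) (simp_all add: sorted_wrt_rev del: upt_Suc)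
  then show ?thesis by (simp only: rev_is_rev_conv)
qed

lemma omega_shape:
  "omega (Suc m) shape u v = array_weight u (1 - u - v) S * v ^ (\<Sum>j\<in>set (free_positions m S). Suc j)"
proof -
  have "omega (Suc m) shape u v = u ^ (\<Sum>i=1..num_rows S. row_len S i) *
      (1 - u - v) ^ (\<Sum>i=1..num_rows S. S i i - row_len S i) * v ^ ((Suc m choose 2) - (\<Sum>i=1..num_rows S. S i i))"
  proof -
    have "(\<Sum>i=1..num_rows S. frob_a shape i + 1) = (\<Sum>i=1..num_rows S. row_len S i)"
    proof (intro sum.cong refl)
      fix i assume "i \<in> {1..num_rows S}"
      then show "frob_a shape i + 1 = row_len S i" using frob_a_lam[of i] row_pos[of i] by simp
    qed
    moreover have "(\<Sum>i=1..num_rows S. frob_b shape i - 1 - frob_a shape i) = (\<Sum>i=1..num_rows S. S i i - row_len S i)"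
    proof (intro sum.cong refl)
      fix i assume "i \<in> {1..num_rows S}"
      then show "frob_b shape i - 1 - frob_a shape i = S i i - row_len S i"
        using frob_a_lam[of i] frob_b_lam[of i] row_pos[of i] by simp
    qed
    moreover have "(\<Sum>i=1..num_rows S. frob_b shape i) = (\<Sum>i=1..num_rows S. S i i)"
      by (intro sum.cong refl frob_b_lam) simp_all
    ultimately show ?thesis by (simp only: omega_def Let_def durfee_lam)
  qed
  then show ?thesis
    by (simp add: array_weight_def sum_free_positions prod.distrib power_sum)
qed

lemma list_alt_array:
  fixes v :: "'a::comm_ring_1" and x :: "nat \<Rightarrow> 'a"
  shows "list_alt (array_columns (\<lambda>a t. t ^ (Suc m + a)) S @ [\<lambda>t. t ^ m] @
      map (\<lambda>j t. v ^ Suc j * t ^ (m - Suc j)) (free_positions m S)) x =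
    v ^ (\<Sum>j\<in>set (free_positions m S). Suc j) * ((\<Prod>i=1..Suc m. \<Prod>j\<in>{i<..Suc m}. x i - x j) * schur shape (Suc m) x)"
proof -
  let ?F = "free_positions m S" and ?P = "array_columns (\<lambda>a t. t ^ (Suc m + a)) S @ [\<lambda>t. t ^ m]"
  \<comment> \<open>Singleton choice sets turn \<open>list_alt_expand\<close> into the extraction of
    scalars from columns.\<close>
  have "choices (set ?F) (\<lambda>_. {0}) = {\<lambda>_. 0}" by (auto simp: choices_def)
  moreover have "distinct ?F" by (simp add: free_positions_def)
  ultimately have "list_alt (?P @ map (\<lambda>j t. v ^ Suc j * t ^ (m - Suc j)) ?F) x =
     (\<Prod>j\<in>set ?F. v ^ Suc j) * list_alt (?P @ map (\<lambda>j t. t ^ (m - Suc j)) ?F) x"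
    using list_alt_expand[of ?F "\<lambda>_. {0}" ?P "\<lambda>j _. v ^ Suc j" "\<lambda>j _ t. t ^ (m - Suc j)" "[]" x] by simp
  moreover have "array_columns (\<lambda>a (t::'a). t ^ (Suc m + a)) S = map (\<lambda>e t. t ^ e) (map (\<lambda>i. m + row_len S i) [1..<Suc (num_rows S)])"
    unfolding array_columns_def map_map comp_def
  proof (rule map_cong[OF refl])
    fix i assume "i \<in> set [1..<Suc (num_rows S)]"
    then have "Suc m + (row_len S i - 1) = m + row_len S i" using row_pos[of i] by auto
    then show "(\<lambda>t::'a. t ^ (Suc m + (row_len S i - 1))) = (\<lambda>t. t ^ (m + row_len S i))" by simp
  qed
  moreover have "map (\<lambda>e t. t ^ e) (map (\<lambda>i. m + row_len S i) [1..<Suc (num_rows S)]) @ [\<lambda>t. t ^ m] @ map (\<lambda>j t. t ^ (m - Suc j)) ?F =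
     map (\<lambda>e (t::'a). t ^ e) array_exponents"
    by (simp add: array_exponents_def comp_def)
  moreover have "list_alt (map (\<lambda>e t. t ^ e) array_exponents) x = alternant (Suc m) (\<lambda>i t. t ^ (shape i + Suc m - i)) x"
    unfolding array_exponents_eq list_alt_def
    by (simp del: upt_Suc, rule alternant_cong) (auto simp del: upt_Suc)
  ultimately show ?thesis
    by (simp only: append_assoc alternant_eq_schur[OF partition_shape] power_sum)
qed

end

theorem theorem1p3:
  fixes n :: nat and u v :: "'a::comm_ring_1" and x :: "nat \<Rightarrow> 'a"
  assumes "1 \<le> n"
  shows "asym n (A_summand u v n) x =
         vandermonde n x *
         (\<Sum>T\<in>TSPP (n - 1). omega n (pi_part (n - 1) T) u v * schur (pi_part (n - 1) T) n x)"
proof -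
  obtain m where n: "n = Suc m" using assms by (cases n) auto
  let ?w = "1 - u - v"
  let ?V = "\<Prod>i=1..n. \<Prod>j\<in>{i<..n}. x i - x j"
  let ?h = "\<lambda>j t. v ^ Suc j * t ^ (m - Suc j)" and ?f = "\<lambda>a t. t ^ (Suc m + a)"
  let ?shape = "\<lambda>S. frob_part (num_rows S) (\<lambda>i. row_len S i - 1) (\<lambda>i. S i i)"
  \<comment> \<open>The column \<open>c = 0\<close> serves as the initial \<open>Z\<close>, so that
    the exponent \<open>length Z + j\<close> is \<open>c = Suc j\<close>.\<close>
  have tcol: "tcol u v ?w m (Suc j) = (\<lambda>t. ?h j t + (- 1) ^ (length [\<lambda>t::'a. t ^ m] + j) * gcol u ?w j ?f t)" for j
    using gcol_power[of u ?w j "Suc m" "\<lambda>_. 1"] by (simp add: tcol_def fun_eq_iff)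
  have "alternant n (\<lambda>i. tcol u v ?w (n - 1) (i - 1)) x =
      list_alt ([\<lambda>t. t ^ m] @ map (\<lambda>j. tcol u v ?w m (Suc j)) [0..<m]) x"
    unfolding list_alt_def n
    by (simp, rule alternant_cong) (auto simp: nth_Cons tcol_def[where c=0] split: nat.splits)
  also have "\<dots> = (\<Sum>S\<in>shifted_arrays m. array_weight u ?w S *
      list_alt (array_columns ?f S @ [\<lambda>t. t ^ m] @ map ?h (free_positions m S)) x)"
    unfolding tcol by (rule list_alt_shifted_expansion)
  also have "\<dots> = (\<Sum>S\<in>shifted_arrays m. ?V * (omega n (?shape S) u v * schur (?shape S) n x))"
    by (intro sum.cong refl) (simp only: list_alt_array omega_shape n mult.assoc mult.left_commute)
  also have "\<dots> = (\<Sum>T\<in>TSPP m. ?V * (omega n (?shape (tspp_array T)) u v * schur (?shape (tspp_array T)) n x))"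
    by (rule sum_TSPP[symmetric])
  also have "\<dots> = ?V * (\<Sum>T\<in>TSPP m. omega n (pi_part m T) u v * schur (pi_part m T) n x)"
    unfolding sum_distrib_left by (intro sum.cong refl) (simp only: pi_part_eq)
  \<comment> \<open>The antisymmetrizer and the Vandermonde product carry the same reversal sign, so
    none remains.\<close>
  finally show ?thesis
    unfolding asym_A_summand vandermonde_rev_perm by (simp add: n mult.assoc)
qed

end
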